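(* Let $p$ be a prime. If a finitely generated group $G$ has polynomial-time worst-case complexity of the word problem and there is a surjective homomorphism from $G$ onto the wreath product of $\mathbb{Z}_p$ and $\mathbb{Z}$, then the average-case time complexity of the word problem in $G$ is linear.
   Context: $\mathbb{Z}_p$ is the cyclic group of order $p$; the wreath product of $\mathbb{Z}_p$ and $\mathbb{Z}$ is the (generalized) lamplighter group $\left(\bigoplus_{i\in\mathbb{Z}}\mathbb{Z}_p\right)\rtimes\mathbb{Z}$, with $\mathbb{Z}$ acting by shifting coordinates. Algorithms run on multitape Turing machines. A group $G$ is given with a fixed finite generating set $X$; inputs are arbitrary (not necessarily freely reduced) words in the alphabet $X\cup X^{-1}$, and $W_n$ denotes the set of all such words of length $n$. The word problem: given a word $w$, decide whether $w=1$ in $G$. For an algorithm, $T(w)$ is its running time on input $w$. Polynomial-time worst-case complexity means that there is an algorithm solving the word problem and some $k\ge 1$ with $T(w)=O(n^k)$ for $w\in W_n$. The average-case time complexity of the word problem in $G$ is linear if there is an algorithm solving the word problem in $G$ for which $\frac{1}{|W_n|}\sum_{w\in W_n}T(w)=O(n)$. *)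

theory Defs
  imports
    "HOL-Algebra.Product_Groups"
    "HOL-Library.Landau_Symbols"
    "HOL-Computational_Algebra.Primes"
begin

section \<open>Deterministic multitape Turing machines\<close>

datatype 'a symbol = Blank | Input 'a | Aux nat

datatype move = Move_Left | Stay | Move_Right

record 'a tm =
  tapes :: nat
  states :: "nat set"
  start :: nat
  accept :: nat
  reject :: nat
  symbols :: "'a symbol set"
  trans :: "nat \<Rightarrow> 'a symbol list \<Rightarrow> nat \<times> ('a symbol \<times> move) list"

text \<open>
  The values of \<^term>\<open>trans M\<close> in the two halting states, or on lists of symbols that do not
  describe the contents of \<^term>\<open>tapes M\<close> scanned cells, are irrelevant.
\<close>

definition turing_machine :: "'a set \<Rightarrow> 'a tm \<Rightarrow> bool" where
  "turing_machine A M \<longleftrightarrow>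
     tapes M \<ge> 1 \<and>
     finite (states M) \<and> {start M, accept M, reject M} \<subseteq> states M \<and> accept M \<noteq> reject M \<and>
     finite (symbols M) \<and> Blank \<in> symbols M \<and> Input ` A \<subseteq> symbols M \<and>
     (\<forall>q \<in> states M - {accept M, reject M}.
        \<forall>ss \<in> lists (symbols M). length ss = tapes M \<longrightarrow>
          (case trans M q ss of (q', acts) \<Rightarrow>
             q' \<in> states M \<and> length acts = tapes M \<and> fst ` set acts \<subseteq> symbols M))"

text \<open>A two-way infinite tape together with the position of its head.\<close>

type_synonym 'a tape = "int \<times> (int \<Rightarrow> 'a symbol)"

type_synonym 'a config = "nat \<times> 'a tape list"

fun scan :: "'a tape \<Rightarrow> 'a symbol" where
  "scan (i, t) = t i"

fun displacement :: "move \<Rightarrow> int" where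
  "displacement Move_Left = -1"
| "displacement Stay = 0"
| "displacement Move_Right = 1"

fun act :: "'a symbol \<times> move \<Rightarrow> 'a tape \<Rightarrow> 'a tape" where
  "act (s, m) (i, t) = (i + displacement m, t(i := s))"

definition halting :: "'a tm \<Rightarrow> 'a config \<Rightarrow> bool" where
  "halting M c \<longleftrightarrow> fst c = accept M \<or> fst c = reject M"

definition step :: "'a tm \<Rightarrow> 'a config \<Rightarrow> 'a config" where
  "step M c =
     (if halting M c then c
      else let (q', acts) = trans M (fst c) (map scan (snd c))
           in (q', map2 act acts (snd c)))"

definition blank_tape :: "'a tape" where
  "blank_tape = (0, \<lambda>_. Blank)"

definition input_tape :: "'a list \<Rightarrow> 'a tape" where
  "input_tape w =
     (0, \<lambda>i. if 0 \<le> i \<and> i < int (length w) then Input (w ! nat i) else Blank)"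

definition initial :: "'a tm \<Rightarrow> 'a list \<Rightarrow> 'a config" where
  "initial M w = (start M, input_tape w # replicate (tapes M - 1) blank_tape)"

definition config_at :: "'a tm \<Rightarrow> 'a list \<Rightarrow> nat \<Rightarrow> 'a config" where
  "config_at M w t = (step M ^^ t) (initial M w)"

text \<open>Only meaningful if the machine halts on the given input, cf. \<open>decides\<close> below.\<close>

definition running_time :: "'a tm \<Rightarrow> 'a list \<Rightarrow> nat" where
  "running_time M w = (LEAST t. halting M (config_at M w t))"

text \<open>
  Halting configurations are fixed by \<^const>\<open>step\<close> and the two halting states are distinct, so
  this says that the machine halts on every word over \<open>A\<close> with the correct answer.
\<close>

definition decides :: "'a set \<Rightarrow> 'a tm \<Rightarrow> 'a list set \<Rightarrow> bool" where
  "decides A M L \<longleftrightarrow>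
     turing_machine A M \<and>
     (\<forall>w \<in> lists A. \<exists>t. fst (config_at M w t) = (if w \<in> L then accept M else reject M))"


section \<open>The word problem and its time complexity\<close>

text \<open>
  The letters are formal: \<open>Inv x\<close> is a letter different from every \<open>Gen y\<close>, even if, for
  example, \<open>x\<close> is an involution of the group.
\<close>

datatype 'g letter = Gen 'g | Inv 'g

definition letters :: "'g set \<Rightarrow> 'g letter set" where
  "letters X = Gen ` X \<union> Inv ` X"

definition words :: "'g set \<Rightarrow> nat \<Rightarrow> 'g letter list set" where
  "words X n = {w \<in> lists (letters X). length w = n}"

fun letter_value :: "('g, 'b) monoid_scheme \<Rightarrow> 'g letter \<Rightarrow> 'g" where
  "letter_value G (Gen x) = x"
| "letter_value G (Inv x) = inv\<^bsub>G\<^esub> x"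

definition word_value :: "('g, 'b) monoid_scheme \<Rightarrow> 'g letter list \<Rightarrow> 'g" where
  "word_value G w = foldr (\<otimes>\<^bsub>G\<^esub>) (map (letter_value G) w) \<one>\<^bsub>G\<^esub>"

definition solves_word_problem ::
    "('g, 'b) monoid_scheme \<Rightarrow> 'g set \<Rightarrow> 'g letter tm \<Rightarrow> bool" where
  "solves_word_problem G X M \<longleftrightarrow>
     decides (letters X) M {w \<in> lists (letters X). word_value G w = \<one>\<^bsub>G\<^esub>}"

definition polynomial_worst_case_word_problem :: "('g, 'b) monoid_scheme \<Rightarrow> 'g set \<Rightarrow> bool" where
  "polynomial_worst_case_word_problem G X \<longleftrightarrow>
     (\<exists>M. solves_word_problem G X M \<and>
        (\<exists>k \<ge> 1. \<exists>C. \<forall>\<^sub>F n in sequentially.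
           \<forall>w \<in> words X n. real (running_time M w) \<le> C * real n ^ k))"

definition average_time :: "'g set \<Rightarrow> 'g letter tm \<Rightarrow> nat \<Rightarrow> real" where
  "average_time X M n = (\<Sum>w \<in> words X n. real (running_time M w)) / real (card (words X n))"

definition linear_average_case_word_problem :: "('g, 'b) monoid_scheme \<Rightarrow> 'g set \<Rightarrow> bool" where
  "linear_average_case_word_problem G X \<longleftrightarrow>
     (\<exists>M. solves_word_problem G X M \<and> average_time X M \<in> O(\<lambda>n. real n))"


section \<open>The wreath product of a cyclic group with the integers\<close>

definition semidirect_product ::
    "('n, 'b) monoid_scheme \<Rightarrow> ('h, 'c) monoid_scheme \<Rightarrow> ('h \<Rightarrow> 'n \<Rightarrow> 'n) \<Rightarrow> ('n \<times> 'h) monoid" where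
  "semidirect_product N H \<phi> =
     \<lparr>carrier = carrier N \<times> carrier H,
      monoid.mult = (\<lambda>(n, h) (n', h'). (n \<otimes>\<^bsub>N\<^esub> \<phi> h n', h \<otimes>\<^bsub>H\<^esub> h')),
      one = (\<one>\<^bsub>N\<^esub>, \<one>\<^bsub>H\<^esub>)\<rparr>"

definition lamplighter_group :: "nat \<Rightarrow> ((int \<Rightarrow> int) \<times> int) monoid" where
  "lamplighter_group p =
     semidirect_product (sum_group UNIV (\<lambda>_ :: int. integer_mod_group p)) integer_group
       (\<lambda>k f i. f (i - k))"

lemma group_semidirect_product:
  assumes "group N" "group H"
    and hom: "\<And>h. h \<in> carrier H \<Longrightarrow> \<phi> h \<in> hom N N"
    and one: "\<And>n. n \<in> carrier N \<Longrightarrow> \<phi> \<one>\<^bsub>H\<^esub> n = n"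
    and mult: "\<And>h h' n. \<lbrakk>h \<in> carrier H; h' \<in> carrier H; n \<in> carrier N\<rbrakk>
                 \<Longrightarrow> \<phi> (h \<otimes>\<^bsub>H\<^esub> h') n = \<phi> h (\<phi> h' n)"
  shows "group (semidirect_product N H \<phi>)"
proof -
  interpret N: group N by fact
  interpret H: group H by fact
  have closed: "\<phi> h n \<in> carrier N" if "h \<in> carrier H" "n \<in> carrier N" for h n
    using hom[OF that(1)] that(2) by (auto simp: hom_def)
  have distrib: "\<phi> h (n \<otimes>\<^bsub>N\<^esub> n') = \<phi> h n \<otimes>\<^bsub>N\<^esub> \<phi> h n'"
    if "h \<in> carrier H" "n \<in> carrier N" "n' \<in> carrier N" for h n n'
    using hom[OF that(1)] that(2,3) by (auto simp: hom_def)
  have linv: "\<exists>y \<in> carrier N \<times> carrier H.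
      y \<otimes>\<^bsub>semidirect_product N H \<phi>\<^esub> x = \<one>\<^bsub>semidirect_product N H \<phi>\<^esub>"
    if x: "x \<in> carrier N \<times> carrier H" for x
  proof -
    obtain n h where [simp]: "x = (n, h)" and nh: "n \<in> carrier N" "h \<in> carrier H"
      using x by auto
    show ?thesis
      using nh closed[of "inv\<^bsub>H\<^esub> h" n]
      by (intro bexI[of _ "(inv\<^bsub>N\<^esub> (\<phi> (inv\<^bsub>H\<^esub> h) n), inv\<^bsub>H\<^esub> h)"])
        (auto simp: semidirect_product_def)
  qed
  show ?thesis
    by (rule groupI)
      (use linv in \<open>auto simp: semidirect_product_def closed distrib one mult N.m_assoc H.m_assoc\<close>)
qed

lemma group_lamplighter_group: "group (lamplighter_group p)"
  unfolding lamplighter_group_def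
proof (rule group_semidirect_product)
  have fin: "finite {i. f (i - k) \<noteq> 0}" if "finite {i. f i \<noteq> (0 :: int)}" for f and k :: int
  proof -
    have "{i. f (i - k) \<noteq> 0} = (\<lambda>i. i + k) ` {i. f i \<noteq> 0}"
      by (auto intro!: image_eqI[of _ _ "_ - k"])
    with that show ?thesis by simp
  qed
  show "(\<lambda>f i. f (i - k)) \<in> hom (sum_group UNIV (\<lambda>_. integer_mod_group p))
      (sum_group UNIV (\<lambda>_. integer_mod_group p))" for k :: int
    by (auto simp: hom_def carrier_sum_group restrict_UNIV fin)
qed (auto simp: algebra_simps)

end

theory Submission
  imports Defs "HOL-Real_Asymp.Real_Asymp" "HOL-Library.Countable" "HOL-Library.Sublist"
begin

text \<open>
  While reading \<open>w\<close>, a machine with three extra tapes tracks the image of \<open>w\<close> in the lamplighter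
  group in linear time: one tape holds the lamps under the lamplighter, the other two are unary
  counters for the number of lit lamps and for the position. If the image is nontrivial, it rejects;
  otherwise it runs the given polynomial-time machine. So it suffices that the probability
  that a random word of length \<open>n\<close> has trivial image decays faster than any power of \<open>n\<close>.

  For this, let \<open>f\<close> be the distribution of the walk after \<open>n\<close> steps and \<open>u n = \<parallel>f\<parallel>\<^sup>2\<close> the
  probability to return after \<open>2 n\<close> steps. If \<open>y\<close> is a product of \<open>2 r\<close> letters, then the triangle
  inequality bounds \<open>\<parallel>f (\<cdot> y) - f\<parallel>\<close> by \<open>r\<close> times the Dirichlet norm of \<open>f\<close>, which is a multiple of
  \<open>u n - u (n + 1)\<close>. Averaging \<open>\<langle>f, f (\<cdot> y)\<rangle>\<close> over the \<open>V\<close> elements \<open>y\<close> of this form yields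
  \<open>u n \<le> 1 / V + (r d)\<^sup>2 (u n - u (n + 1))\<close> with \<open>d\<close> the number of letters, whence
  \<open>u n \<le> 1 / V + (1 - 1 / (r d)\<^sup>2) ^ n\<close>. The lamplighter group contains a free semigroup, so \<open>V\<close> grows
  exponentially in \<open>r\<close>, and \<open>r \<approx> n powr (1 / 4)\<close> gives the claim.
\<close>

section \<open>Return probabilities of symmetric random walks\<close>

text \<open>Letters are kept apart from their values: different letters may have the same value, and
  the walk is uniform on letters, so probabilities become counts of words. The involution
  \<open>\<iota>\<close> makes the step distribution symmetric.\<close>

locale symmetric_walk = group H for H :: "('h, 'b) monoid_scheme" (structure) +
  fixes S :: "'s set" and \<phi> :: "'s \<Rightarrow> 'h" and \<iota> :: "'s \<Rightarrow> 's"
  assumes finite_S: "finite S" and S_nonempty: "S \<noteq> {}"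
    and \<phi>_closed: "s \<in> S \<Longrightarrow> \<phi> s \<in> carrier H"
    and \<iota>_closed: "s \<in> S \<Longrightarrow> \<iota> s \<in> S"
    and \<iota>_\<iota>: "s \<in> S \<Longrightarrow> \<iota> (\<iota> s) = s"
    and \<phi>_\<iota>: "s \<in> S \<Longrightarrow> \<phi> (\<iota> s) = inv \<phi> s"
begin

section \<open>Words over the letters, their values and their formal inverses\<close>

definition val :: "'s list \<Rightarrow> 'h" where
  "val w = foldr (\<otimes>) (map \<phi> w) \<one>"

definition W :: "nat \<Rightarrow> 's list set" where
  "W n = {w \<in> lists S. length w = n}"

text \<open>Up to the factor \<open>card S ^ (2 * n)\<close>, the inner product of the distribution
  of the walk after \<open>n\<close> steps with its right translate by \<open>y\<close>. Counting
  pairs of words avoids sums over a possibly infinite group.\<close>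

definition correlation :: "nat \<Rightarrow> 'h \<Rightarrow> nat" where
  "correlation n y = card {(w, w') \<in> W n \<times> W n. val w' = val w \<otimes> y}"

lemma val_simps [simp]: "val [] = \<one>" "val (s # w) = \<phi> s \<otimes> val w"
  by (simp_all add: val_def)

lemma val_closed [simp]: "w \<in> lists S \<Longrightarrow> val w \<in> carrier H"
  by (induction w) (auto simp: \<phi>_closed)

lemma val_append: "v \<in> lists S \<Longrightarrow> w \<in> lists S \<Longrightarrow> val (v @ w) = val v \<otimes> val w"
  by (induction v) (auto simp: \<phi>_closed m_assoc)

lemma W_lists: "w \<in> W n \<Longrightarrow> w \<in> lists S"
  by (simp add: W_def)

lemma W_val_closed [simp]: "w \<in> W n \<Longrightarrow> val w \<in> carrier H"
  by (simp add: W_def)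

lemma finite_W [simp]: "finite (W n)"
  using finite_lists_length_eq[OF finite_S, of n]
  by (simp add: W_def lists_eq_set Collect_conj_eq[symmetric] conj_commute)

lemma finite_W_pairs: "finite {(v, w) \<in> W n \<times> W n. P v w}"
  by (rule finite_subset[of _ "W n \<times> W n"]) auto

lemma card_W: "card (W n) = card S ^ n"
  using card_lists_length_eq[OF finite_S, of n]
  by (simp add: W_def lists_eq_set conj_commute)

lemma W_Suc: "W (Suc n) = (\<lambda>(w, s). w @ [s]) ` (W n \<times> S)"
proof (intro equalityI subsetI)
  fix w assume "w \<in> W (Suc n)"
  then show "w \<in> (\<lambda>(w, s). w @ [s]) ` (W n \<times> S)"
    by (cases w rule: rev_cases) (auto simp: W_def intro!: rev_image_eqI)
qed (auto simp: W_def)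

lemma W_add: "W (m + n) = (\<lambda>(v, w). v @ w) ` (W m \<times> W n)"
proof (intro equalityI subsetI)
  fix w assume w: "w \<in> W (m + n)"
  then have "w = (\<lambda>(v, w). v @ w) (take m w, drop m w)" "(take m w, drop m w) \<in> W m \<times> W n"
    by (auto simp: W_def dest: in_set_takeD in_set_dropD)
  then show "w \<in> (\<lambda>(v, w). v @ w) ` (W m \<times> W n)" by (rule image_eqI)
qed (auto simp: W_def)

definition winv :: "'s list \<Rightarrow> 's list" where
  "winv w = rev (map \<iota> w)"

lemma winv_W: "w \<in> W n \<Longrightarrow> winv w \<in> W n"
  by (auto simp: W_def winv_def \<iota>_closed)

lemma winv_winv: "w \<in> W n \<Longrightarrow> winv (winv w) = w"
  by (auto simp: W_def winv_def rev_map o_def \<iota>_\<iota> intro!: map_idI)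

lemma val_winv: "w \<in> lists S \<Longrightarrow> val (winv w) = inv (val w)"
proof (induction w)
  case (Cons s w)
  then have "winv w \<in> lists S" "s \<in> S"
    by (auto simp: winv_def \<iota>_closed)
  with Cons show ?case
    by (simp add: winv_def val_append \<iota>_closed \<phi>_\<iota> \<phi>_closed inv_mult_group)
qed (simp add: winv_def)

lemma bij_\<iota>: "bij_betw \<iota> S S"
  by (rule bij_betw_byWitness[where f' = \<iota>]) (auto simp: \<iota>_closed \<iota>_\<iota>)

text \<open>A pair of words determines the only \<open>y\<close> for which it is counted, so
  distinct \<open>y\<close> give disjoint subsets of \<open>W n \<times> W n\<close>.\<close>

lemma sum_correlation_le:
  assumes "finite B" "B \<subseteq> carrier H"
  shows "(\<Sum>y\<in>B. correlation n y) \<le> card S ^ (2 * n)"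
proof -
  have "(\<Sum>y\<in>B. correlation n y) = card (\<Union>y\<in>B. {(w, w') \<in> W n \<times> W n. val w' = val w \<otimes> y})"
    unfolding correlation_def
    by (subst card_UN_disjoint)
      (use assms in \<open>auto simp: finite_W_pairs[simplified] subset_eq\<close>)
  also have "\<dots> \<le> card (W n \<times> W n)"
    by (intro card_mono) auto
  finally show ?thesis by (simp add: card_cartesian_product card_W power_add mult_2)
qed

text \<open>Removing the last letters \<open>s\<close> and \<open>s'\<close> turns equality of
  values into a relation between the shorter words, twisted by \<open>\<phi> s\<close> and the
  inverse of \<open>\<phi> s'\<close>. As \<open>\<iota>\<close> permutes \<open>S\<close>, the
  inverse disappears in the sum over all \<open>s'\<close>.\<close>

lemma correlation_Suc:
  "correlation (Suc n) \<one> = (\<Sum>(s, s') \<in> S \<times> S. correlation n (\<phi> s \<otimes> \<phi> s'))"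
proof -
  let ?A = "\<lambda>(s, s'). {(w, w') \<in> W n \<times> W n. val w' = val w \<otimes> (\<phi> s \<otimes> \<phi> (\<iota> s'))}"
  have eq: "val w \<otimes> \<phi> s = val w' \<otimes> \<phi> s' \<longleftrightarrow> val w' = val w \<otimes> (\<phi> s \<otimes> \<phi> (\<iota> s'))"
    if "w \<in> W n" "w' \<in> W n" "s \<in> S" "s' \<in> S" for w w' s s'
  proof
    assume "val w \<otimes> \<phi> s = val w' \<otimes> \<phi> s'"
    then have "val w \<otimes> \<phi> s \<otimes> inv \<phi> s' = val w' \<otimes> \<phi> s' \<otimes> inv \<phi> s'" by simp
    with that show "val w' = val w \<otimes> (\<phi> s \<otimes> \<phi> (\<iota> s'))"
      by (simp add: m_assoc \<phi>_\<iota> \<phi>_closed)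
  qed (use that in \<open>simp add: m_assoc \<phi>_\<iota> \<phi>_closed\<close>)
  have "correlation (Suc n) \<one> = card {(w, w') \<in> W (Suc n) \<times> W (Suc n). val w' = val w}"
    unfolding correlation_def by (rule arg_cong[of _ _ card]) auto
  also have "\<dots> = card (Sigma (S \<times> S) ?A)"
  proof (rule bij_betw_same_card[symmetric])
    show "bij_betw (\<lambda>((s, s'), (w, w')). (w @ [s], w' @ [s'])) (Sigma (S \<times> S) ?A)
            {(w, w') \<in> W (Suc n) \<times> W (Suc n). val w' = val w}"
      unfolding bij_betw_def
    proof
      show "inj_on (\<lambda>((s, s'), (w, w')). (w @ [s], w' @ [s'])) (Sigma (S \<times> S) ?A)"
        by (auto simp: inj_on_def)
      show "(\<lambda>((s, s'), (w, w')). (w @ [s], w' @ [s'])) ` Sigma (S \<times> S) ?A =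
          {(w, w') \<in> W (Suc n) \<times> W (Suc n). val w' = val w}"
      proof (intro equalityI subsetI)
        fix x assume "x \<in> {(w, w') \<in> W (Suc n) \<times> W (Suc n). val w' = val w}"
        then obtain w s w' s' where x: "x = (w @ [s], w' @ [s'])" "w \<in> W n" "w' \<in> W n" "s \<in> S" "s' \<in> S"
            and v: "val (w' @ [s']) = val (w @ [s])"
          by (auto simp: W_Suc)
        then have "val w \<otimes> \<phi> s = val w' \<otimes> \<phi> s'" using x
          by (simp add: val_append W_lists \<phi>_closed)
        then show "x \<in> (\<lambda>((s, s'), (w, w')). (w @ [s], w' @ [s'])) ` Sigma (S \<times> S) ?A"
          using x eq[of w w' s s'] by (intro image_eqI[of _ _ "((s, s'), (w, w'))"]) auto
      next
        fix x assume "x \<in> (\<lambda>((s, s'), (w, w')). (w @ [s], w' @ [s'])) ` Sigma (S \<times> S) ?A"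
        then obtain w s w' s' where x: "x = (w @ [s], w' @ [s'])" "w \<in> W n" "w' \<in> W n" "s \<in> S" "s' \<in> S"
            and v: "val w' = val w \<otimes> (\<phi> s \<otimes> \<phi> (\<iota> s'))" by auto
        with eq[of w w' s s'] have "val w \<otimes> \<phi> s = val w' \<otimes> \<phi> s'" by simp
        with x show "x \<in> {(w, w') \<in> W (Suc n) \<times> W (Suc n). val w' = val w}"
          by (auto simp: W_Suc val_append W_lists \<phi>_closed)
      qed
    qed
  qed
  also have "\<dots> = (\<Sum>x \<in> S \<times> S. card (?A x))"
    by (rule card_SigmaI) (auto simp: finite_S finite_W_pairs simp del: mem_Sigma_iff)
  also have "\<dots> = (\<Sum>s\<in>S. \<Sum>s'\<in>S. correlation n (\<phi> s \<otimes> \<phi> (\<iota> s')))"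
    by (simp add: sum.cartesian_product correlation_def split_def)
  also have "\<dots> = (\<Sum>s\<in>S. \<Sum>s'\<in>S. correlation n (\<phi> s \<otimes> \<phi> s'))"
    by (intro sum.cong refl sum.reindex_bij_betw[OF bij_\<iota>])
  finally show ?thesis by (simp add: sum.cartesian_product)
qed

section \<open>Squared distances between the walk and its translates\<close>

definition mult_count :: "nat \<Rightarrow> 'h \<Rightarrow> real" where
  "mult_count n g = real (card {w \<in> W n. val w = g})"

text \<open>The finite set \<open>K\<close> stands in for the whole group: by the last hypothesis it
  contains every \<open>g\<close> at which the first factor is nonzero.\<close>

lemma sum_mult_count:
  assumes "finite K" "K \<subseteq> carrier H" "a \<in> carrier H" "b \<in> carrier H"
    and K: "\<And>w. w \<in> W n \<Longrightarrow> val w \<otimes> inv a \<in> K"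
  shows "(\<Sum>g\<in>K. mult_count n (g \<otimes> a) * mult_count n (g \<otimes> b)) = real (correlation n (inv a \<otimes> b))"
proof -
  let ?A = "\<lambda>g. {w \<in> W n. val w = g \<otimes> a} \<times> {w \<in> W n. val w = g \<otimes> b}"
  have "(\<Sum>g\<in>K. mult_count n (g \<otimes> a) * mult_count n (g \<otimes> b)) = real (\<Sum>g\<in>K. card (?A g))"
    by (simp add: mult_count_def card_cartesian_product)
  also have "(\<Sum>g\<in>K. card (?A g)) = card (\<Union>g\<in>K. ?A g)"
    by (subst card_UN_disjoint) (use assms in \<open>auto simp: subset_eq\<close>)
  also have "(\<Union>g\<in>K. ?A g) = {(w, w') \<in> W n \<times> W n. val w' = val w \<otimes> (inv a \<otimes> b)}"
  proof (intro equalityI subsetI)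
    fix x assume "x \<in> (\<Union>g\<in>K. ?A g)"
    with assms show "x \<in> {(w, w') \<in> W n \<times> W n. val w' = val w \<otimes> (inv a \<otimes> b)}"
      by (auto simp: m_assoc subset_eq r_inv_ex inv_solve_left')
       (metis inv_closed inv_solve_left' l_one m_assoc m_closed r_inv)
  next
    fix x assume "x \<in> {(w, w') \<in> W n \<times> W n. val w' = val w \<otimes> (inv a \<otimes> b)}"
    then obtain w w' where "x = (w, w')" "w \<in> W n" "w' \<in> W n" "val w' = val w \<otimes> (inv a \<otimes> b)" by auto
    with assms show "x \<in> (\<Union>g\<in>K. ?A g)"
      by (intro UN_I[of "val w \<otimes> inv a"]) (auto simp: m_assoc)
  qed
  finally show ?thesis by (simp add: correlation_def)
qed

abbreviation "defect n y \<equiv> real (correlation n \<one>) - real (correlation n y)"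

text \<open>Expanding the square gives two norms and a mixed term. Translation preserves the norm,
  so both norms are \<open>correlation n \<one>\<close>, and the defect is half the squared distance
  between two translates of the unnormalised distribution.\<close>

lemma defect_eq:
  assumes "finite K" "K \<subseteq> carrier H" "a \<in> carrier H" "b \<in> carrier H"
    and K: "\<And>w. w \<in> W n \<Longrightarrow> val w \<otimes> inv a \<in> K" "\<And>w. w \<in> W n \<Longrightarrow> val w \<otimes> inv b \<in> K"
  shows "(\<Sum>g\<in>K. (mult_count n (g \<otimes> b) - mult_count n (g \<otimes> a))\<^sup>2) = 2 * defect n (inv a \<otimes> b)"
proof -
  have "(\<Sum>g\<in>K. (mult_count n (g \<otimes> b) - mult_count n (g \<otimes> a))\<^sup>2) =
     (\<Sum>g\<in>K. mult_count n (g \<otimes> b) * mult_count n (g \<otimes> b)) +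
     (\<Sum>g\<in>K. mult_count n (g \<otimes> a) * mult_count n (g \<otimes> a)) -
     2 * (\<Sum>g\<in>K. mult_count n (g \<otimes> a) * mult_count n (g \<otimes> b))"
    by (simp add: power2_eq_square algebra_simps sum.distrib sum_subtractf sum_distrib_left)
  also have "\<dots> = 2 * defect n (inv a \<otimes> b)"
    by (subst (1 2 3) sum_mult_count) (use assms in auto)
  finally show ?thesis .
qed

lemma defect_nonneg:
  assumes "y \<in> carrier H"
  shows "defect n y \<ge> 0"
proof -
  let ?K = "val ` W n \<union> (\<lambda>w. val w \<otimes> inv y) ` W n"
  have "0 \<le> (\<Sum>g\<in>?K. (mult_count n (g \<otimes> y) - mult_count n (g \<otimes> \<one>))\<^sup>2)"
    by (intro sum_nonneg) auto
  also have "\<dots> = 2 * defect n (inv \<one> \<otimes> y)"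
    by (rule defect_eq) (use assms in auto)
  finally show ?thesis using assms by simp
qed

text \<open>Young's inequality for the mixed term \<open>2 * a * b\<close>. It serves as a triangle
  inequality without square roots; the weights are those for which the induction in
  \<open>defect_val\<close> closes exactly.\<close>

lemma square_add_le:
  fixes a b r :: real
  assumes "r > 0"
  shows "(a + b)\<^sup>2 \<le> (1 + 1 / r) * a\<^sup>2 + (1 + r) * b\<^sup>2"
proof -
  have "0 \<le> (a - r * b)\<^sup>2 / r" using assms by simp
  also have "\<dots> = (1 + 1 / r) * a\<^sup>2 + (1 + r) * b\<^sup>2 - (a + b)\<^sup>2"
    using assms by (simp add: field_simps power2_eq_square)
  finally show ?thesis by simp
qed

text \<open>The translates by \<open>\<one>\<close>, \<open>y\<close> and
  \<open>y \<otimes> z\<close> are compared one after the other; the second distance depends only on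
  \<open>inv y \<otimes> (y \<otimes> z)\<close>, which is \<open>z\<close>.\<close>

lemma defect_mult:
  assumes "y \<in> carrier H" "z \<in> carrier H" "r > 0"
  shows "defect n (y \<otimes> z) \<le> (1 + 1 / r) * defect n y + (1 + r) * defect n z"
proof -
  \<comment> \<open>The three sets cover the supports of the three translates, as
    \<open>defect_eq\<close> requires.\<close>
  let ?K = "val ` W n \<union> (\<lambda>w. val w \<otimes> inv y) ` W n \<union> (\<lambda>w. val w \<otimes> inv (y \<otimes> z)) ` W n"
  have K: "finite ?K" "?K \<subseteq> carrier H"
    using assms by auto
  let ?N = "mult_count n"
  have "2 * defect n (inv \<one> \<otimes> (y \<otimes> z)) = (\<Sum>g\<in>?K. (?N (g \<otimes> (y \<otimes> z)) - ?N (g \<otimes> \<one>))\<^sup>2)"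
    by (rule defect_eq[symmetric]) (use assms K in auto)
  also have "\<dots> = (\<Sum>g\<in>?K. ((?N (g \<otimes> y) - ?N (g \<otimes> \<one>)) + (?N (g \<otimes> (y \<otimes> z)) - ?N (g \<otimes> y)))\<^sup>2)"
    by simp
  also have "\<dots> \<le> (\<Sum>g\<in>?K. (1 + 1 / r) * (?N (g \<otimes> y) - ?N (g \<otimes> \<one>))\<^sup>2 +
                     (1 + r) * (?N (g \<otimes> (y \<otimes> z)) - ?N (g \<otimes> y))\<^sup>2)"
    by (intro sum_mono square_add_le assms)
  also have "\<dots> = (1 + 1 / r) * (\<Sum>g\<in>?K. (?N (g \<otimes> y) - ?N (g \<otimes> \<one>))\<^sup>2) +
                  (1 + r) * (\<Sum>g\<in>?K. (?N (g \<otimes> (y \<otimes> z)) - ?N (g \<otimes> y))\<^sup>2)"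
    by (simp only: sum.distrib sum_distrib_left)
  also have "(\<Sum>g\<in>?K. (?N (g \<otimes> y) - ?N (g \<otimes> \<one>))\<^sup>2) = 2 * defect n (inv \<one> \<otimes> y)"
    by (rule defect_eq) (use assms K in auto)
  also have "(\<Sum>g\<in>?K. (?N (g \<otimes> (y \<otimes> z)) - ?N (g \<otimes> y))\<^sup>2) = 2 * defect n (inv y \<otimes> (y \<otimes> z))"
    by (rule defect_eq) (use assms K in auto)
  also have "inv y \<otimes> (y \<otimes> z) = z"
    using assms by (simp add: m_assoc[symmetric])
  finally show ?thesis using assms by (simp add: algebra_simps)
qed

text \<open>By \<open>correlation_Suc\<close> this is the sum of the defects of all products of two
  letters, an unnormalised Dirichlet form; after normalisation it becomes a multiple of the drop of
  the return probability.\<close>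

abbreviation "energy n \<equiv> real (card S) ^ 2 * real (correlation n \<one>) - real (correlation (Suc n) \<one>)"

text \<open>One summand of the energy, the others being nonnegative by
  \<open>defect_nonneg\<close>.\<close>

lemma defect_pair:
  assumes "s \<in> S" "s' \<in> S"
  shows "defect n (\<phi> s \<otimes> \<phi> s') \<le> energy n"
proof -
  have "defect n (\<phi> s \<otimes> \<phi> s') = (\<Sum>x\<in>{(s, s')}. defect n (\<phi> (fst x) \<otimes> \<phi> (snd x)))" by simp
  also have "\<dots> \<le> (\<Sum>x\<in>S \<times> S. defect n (\<phi> (fst x) \<otimes> \<phi> (snd x)))"
    by (intro sum_mono2 defect_nonneg) (use assms finite_S \<phi>_closed in auto)
  also have "\<dots> = energy n"
    by (simp add: sum_subtractf card_cartesian_product power2_eq_square correlation_Suc split_def)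
  finally show ?thesis .
qed

text \<open>Induction on the number of two-letter blocks, using \<open>defect_mult\<close> with
  weight \<open>r\<close>: the quadratic growth comes from (1 + 1/r) r^2 + (1 + r) = (r +
  1)^2.\<close>

lemma defect_val:
  assumes "v \<in> W (2 * r)"
  shows "defect n (val v) \<le> real r ^ 2 * energy n"
  using assms
proof (induction r arbitrary: v)
  case 0
  then show ?case by (simp add: W_def)
next
  case (Suc r)
  then have "v \<in> W (2 * r + 2)" by simp
  then obtain u s s' where v: "v = u @ [s, s']" "u \<in> W (2 * r)" "s \<in> S" "s' \<in> S"
    by (force simp: W_Suc numeral_2_eq_2 W_add)
  have val: "val v = val u \<otimes> (\<phi> s \<otimes> \<phi> s')"
    using v by (simp add: val_append W_lists \<phi>_closed)
  have pair: "defect n (\<phi> s \<otimes> \<phi> s') \<le> energy n" using v by (intro defect_pair)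
  show ?case
  proof (cases "r = 0")
    \<comment> \<open>\<open>defect_mult\<close> needs a positive weight, so the first block is
      treated directly.\<close>
    case True
    with v have "u = []" by (simp add: W_def)
    with True pair show ?thesis using v by (simp add: val \<phi>_closed)
  next
    case False
    have "defect n (val v) \<le> (1 + 1 / real r) * defect n (val u) + (1 + real r) * defect n (\<phi> s \<otimes> \<phi> s')"
      unfolding val by (rule defect_mult) (use v False \<phi>_closed in auto)
    also have "\<dots> \<le> (1 + 1 / real r) * (real r ^ 2 * energy n) + (1 + real r) * energy n"
      by (intro add_mono mult_left_mono pair Suc.IH v) auto
    also have "\<dots> = real (Suc r) ^ 2 * energy n"
      using False by (simp add: field_simps power2_eq_square)
    finally show ?thesis .
  qed
qed

section \<open>Decay of the return probabilities at even times\<close>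

definition even_return :: "nat \<Rightarrow> real" where
  "even_return n = real (correlation n \<one>) / real (card S) ^ (2 * n)"

lemma card_S_pos: "card S > 0"
  using finite_S S_nonempty by (simp add: card_gt_0_iff)

text \<open>\<open>defect_val\<close> is averaged over the values \<open>y\<close> of words of
  length \<open>2 * r\<close>. Their correlations add up to at most \<open>card S ^ (2 * n)\<close>,
  which bounds the average correlation and yields the first summand.\<close>

lemma even_return_step:
  "even_return n \<le> 1 / real (card (val ` W (2 * r))) +
     (real r * real (card S))\<^sup>2 * (even_return n - even_return (Suc n))"
proof -
  let ?B = "val ` W (2 * r)" and ?d = "real (card S)"
  have "replicate (2 * r) (SOME s. s \<in> S) \<in> W (2 * r)"
    using S_nonempty by (auto simp: W_def some_in_eq)
  then have V: "real (card ?B) > 0"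
    by (auto simp: card_gt_0_iff)
  have d: "?d > 0" using card_S_pos by simp
  have "real (card ?B) * real (correlation n \<one>) - (\<Sum>y\<in>?B. real (correlation n y)) = (\<Sum>y\<in>?B. defect n y)"
    by (simp add: sum_subtractf)
  also have "\<dots> \<le> (\<Sum>y\<in>?B. real r ^ 2 * energy n)"
    by (intro sum_mono) (auto intro: defect_val)
  finally have "real (card ?B) * real (correlation n \<one>) - (\<Sum>y\<in>?B. real (correlation n y)) \<le>
      real (card ?B) * (real r ^ 2 * energy n)" by simp
  moreover have "(\<Sum>y\<in>?B. real (correlation n y)) \<le> ?d ^ (2 * n)"
    using sum_correlation_le[of ?B n]
    by (simp flip: of_nat_sum of_nat_power add: image_subset_iff W_val_closed)
  ultimately have "real (card ?B) * real (correlation n \<one>) \<le> ?d ^ (2 * n) + real (card ?B) * (real r ^ 2 * energy n)"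
    by linarith
  then have "real (correlation n \<one>) \<le> (?d ^ (2 * n) + real (card ?B) * (real r ^ 2 * energy n)) / real (card ?B)"
    by (subst pos_le_divide_eq[OF V]) (simp only: mult.commute)
  also have "\<dots> = ?d ^ (2 * n) / real (card ?B) + real r ^ 2 * energy n"
    using less_imp_neq[OF V, THEN not_sym] by (simp only: add_divide_distrib nonzero_mult_div_cancel_left not_False_eq_True)
  finally have "real (correlation n \<one>) \<le> ?d ^ (2 * n) / real (card ?B) + real r ^ 2 * energy n" .
  then have "real (correlation n \<one>) / ?d ^ (2 * n) \<le> (?d ^ (2 * n) / real (card ?B) + real r ^ 2 * energy n) / ?d ^ (2 * n)"
    using d by (intro divide_right_mono) auto
  also have "\<dots> = 1 / real (card ?B) + real r ^ 2 * (energy n / ?d ^ (2 * n))"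
    using d by (simp add: add_divide_distrib)
  also have "energy n / ?d ^ (2 * n) = ?d\<^sup>2 * (even_return n - even_return (Suc n))"
    using d by (simp add: even_return_def field_simps power2_eq_square)
  finally show ?thesis by (simp add: even_return_def power_mult_distrib mult.assoc)
qed

lemma correlation_0: "correlation 0 \<one> = 1"
proof -
  have "{(w, w') \<in> W 0 \<times> W 0. val w' = val w \<otimes> \<one>} = {([], [])}"
    by (auto simp: W_def)
  then show ?thesis by (simp add: correlation_def)
qed

text \<open>The excess of \<open>even_return n\<close> over the first summand shrinks by the factor
  \<open>1 - 1 / ?q\<close> in every step and is at most 1 at the start.\<close>

lemma even_return_le:
  assumes "r > 0"
  shows "even_return n \<le> 1 / real (card (val ` W (2 * r))) + (1 - 1 / (real r * real (card S))\<^sup>2) ^ n"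
proof -
  let ?V = "real (card (val ` W (2 * r)))" and ?q = "(real r * real (card S))\<^sup>2"
  have "real r * real (card S) \<ge> 1" using assms card_S_pos
    by (metis One_nat_def Suc_leI mult_pos_pos of_nat_1 of_nat_le_iff of_nat_mult)
  \<comment> \<open>This keeps the contraction factor nonnegative, so that the induction hypothesis
    can be multiplied by it.\<close>
  then have q: "?q \<ge> 1" by simp
  have "even_return n - 1 / ?V \<le> (1 - 1 / ?q) ^ n"
  proof (induction n)
    case 0
    then show ?case by (simp add: even_return_def correlation_0)
  next
    case (Suc n)
    have "even_return n - 1 / ?V \<le> ?q * (even_return n - even_return (Suc n))"
      using even_return_step[of n r] by simp
    then have "(even_return n - 1 / ?V) / ?q \<le> even_return n - even_return (Suc n)"
      using q by (subst pos_divide_le_eq) (simp_all only: mult.commute less_le_trans[OF zero_less_one q])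
    moreover have "(1 - 1 / ?q) * x = x - x / ?q" for x
      by (simp add: left_diff_distrib)
    ultimately have "even_return (Suc n) - 1 / ?V \<le> (1 - 1 / ?q) * (even_return n - 1 / ?V)"
      by (simp only:)
    also have "\<dots> \<le> (1 - 1 / ?q) * (1 - 1 / ?q) ^ n"
      using q by (intro mult_left_mono Suc.IH) (subst diff_ge_0_iff_ge, subst divide_le_eq_1, auto)
    finally show ?case by simp
  qed
  then show ?thesis by simp
qed

section \<open>Return probabilities at arbitrary times\<close>

abbreviation "returning n \<equiv> {w \<in> W n. val w = \<one>}"

text \<open>Formal inversion of the second word is a bijection of \<open>W n\<close> and moves its
  value to the other side of the equation.\<close>

lemma card_pairs_eq_correlation:
  assumes "y \<in> carrier H"
  shows "card {(v, w) \<in> W n \<times> W n. val v \<otimes> y \<otimes> val w = \<one>} = correlation n y"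
  unfolding correlation_def
proof (rule bij_betw_same_card[of "map_prod id winv"],
       rule bij_betw_byWitness[where f' = "map_prod id winv"])
  have *: "inv b = a \<otimes> y \<longleftrightarrow> a \<otimes> y \<otimes> b = \<one>" if "a \<in> carrier H" "b \<in> carrier H" for a b
    using that assms by (metis inv_equality l_inv m_closed)
  show "map_prod id winv ` {(v, w) \<in> W n \<times> W n. val v \<otimes> y \<otimes> val w = \<one>}
      \<subseteq> {(w, w') \<in> W n \<times> W n. val w' = val w \<otimes> y}"
    by (auto simp: winv_W val_winv W_lists *)
  show "map_prod id winv ` {(w, w') \<in> W n \<times> W n. val w' = val w \<otimes> y}
      \<subseteq> {(v, w) \<in> W n \<times> W n. val v \<otimes> y \<otimes> val w = \<one>}"
    using assms by (auto simp: winv_W val_winv W_lists)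
qed (auto simp: winv_winv)

lemma card_returning_even: "card (returning (n + n)) = correlation n \<one>"
proof -
  have "returning (n + n) = (\<lambda>(v, w). v @ w) ` {(v, w) \<in> W n \<times> W n. val v \<otimes> \<one> \<otimes> val w = \<one>}"
    by (auto simp: W_add val_append W_lists image_iff)
  moreover have "inj_on (\<lambda>(v, w). v @ w) {(v, w) \<in> W n \<times> W n. val v \<otimes> \<one> \<otimes> val w = \<one>}"
    by (auto simp: inj_on_def W_def)
  ultimately show ?thesis
    by (simp only: card_image card_pairs_eq_correlation one_closed)
qed

text \<open>The word is cut at its middle letter. Nonnegativity of the defect, a form of
  Cauchy-Schwarz, bounds each twisted correlation by the untwisted one, so returning at an odd time
  is no likelier than at the even time before.\<close>

lemma card_returning_odd: "card (returning (Suc (n + n))) \<le> card S * correlation n \<one>"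
proof -
  let ?A = "\<lambda>s. {(v, w) \<in> W n \<times> W n. val v \<otimes> \<phi> s \<otimes> val w = \<one>}"
  have "returning (Suc n + n) \<subseteq> (\<Union>s\<in>S. (\<lambda>(v, w). v @ s # w) ` ?A s)"
  proof
    fix x assume "x \<in> returning (Suc n + n)"
    then obtain v s w where "x = (v @ [s]) @ w" "v \<in> W n" "s \<in> S" "w \<in> W n" "val x = \<one>"
      by (auto simp only: W_add W_Suc)
    then show "x \<in> (\<Union>s\<in>S. (\<lambda>(v, w). v @ s # w) ` ?A s)"
      by (fastforce simp: val_append W_lists \<phi>_closed m_assoc image_iff)
  qed
  then have "card (returning (Suc n + n)) \<le> card (\<Union>s\<in>S. (\<lambda>(v, w). v @ s # w) ` ?A s)"
    by (intro card_mono) (auto simp: finite_S intro!: finite_imageI finite_W_pairs simp del: mem_Sigma_iff)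
  also have "\<dots> \<le> (\<Sum>s\<in>S. card ((\<lambda>(v, w). v @ s # w) ` ?A s))"
    by (intro card_UN_le finite_S)
  also have "\<dots> \<le> (\<Sum>s\<in>S. correlation n (\<phi> s))"
    by (intro sum_mono, subst card_pairs_eq_correlation[symmetric])
       (auto simp: \<phi>_closed intro!: card_image_le finite_W_pairs simp del: mem_Sigma_iff)
  also have "\<dots> \<le> (\<Sum>s\<in>S. correlation n \<one>)"
    by (intro sum_mono) (use defect_nonneg[OF \<phi>_closed, of _ n] in auto)
  finally show ?thesis by simp
qed

lemma return_probability_le:
  "real (card (returning n)) / real (card S) ^ n \<le> even_return (n div 2)"
proof (cases "even n")
  case True
  then obtain m where "n = m + m" by (auto elim!: evenE simp: mult_2)
  then show ?thesis by (simp add: card_returning_even even_return_def mult_2)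
next
  case False
  then obtain m where n: "n = Suc (m + m)" by (auto elim!: oddE simp: mult_2)
  have "real (card (returning n)) \<le> real (card S) * real (correlation m \<one>)"
    using card_returning_odd[of m] unfolding n by (simp flip: of_nat_mult)
  then have "real (card (returning n)) / real (card S) ^ n \<le>
      real (card S) * real (correlation m \<one>) / real (card S) ^ n"
    by (intro divide_right_mono) auto
  then show ?thesis using card_S_pos by (simp add: n even_return_def mult_2)
qed

lemma superpolynomial_return_decay:
  fixes k :: nat
  assumes "h > 0" and growth: "\<And>m. card (val ` W (2 * (h * m))) \<ge> 2 ^ m"
  shows "\<forall>\<^sub>F n in sequentially. real n ^ k * (real (card (returning n)) / real (card S) ^ n) \<le> 1"
proof -
  define c :: real where "c = 1 / (real h * real (card S))\<^sup>2"
  have c: "c > 0" using assms(1) card_S_pos by (simp add: c_def)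
  \<comment> \<open>\<open>even_return_le\<close> is applied with \<open>r = h * l n\<close>. Then
    the first term is at most \<open>1 / 2 ^ l n\<close>, and the exponent in the second, of order n
    / r^2, is at least of order sqrt n. Both terms decay faster than any power of
    \<open>n\<close>.\<close>
  define l where "l = (\<lambda>n. nat \<lfloor>real n powr (1 / 4)\<rfloor>)"
  have bound: "real (card (returning n)) / real (card S) ^ n \<le>
      2 powr (1 - real n powr (1 / 4)) + exp (- c * (real n / 2 - 1) / sqrt (real n))" if "n \<ge> 1" for n
  proof -
    have "real n powr (1 / 4) \<ge> 1" using that by (simp add: ge_one_powr_ge_zero)
    then have l: "l n \<ge> 1" "real (l n) \<le> real n powr (1/4)" "real (l n) \<ge> real n powr (1 / 4) - 1"
      unfolding l_def by linarith+
    have "(real (l n))\<^sup>2 \<le> (real n powr (1 / 4))\<^sup>2" using l by (intro power_mono) auto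
    also have "\<dots> = sqrt (real n)"
      using that by (simp add: power2_eq_square powr_add[symmetric] powr_half_sqrt)
    finally have l2: "(real (l n))\<^sup>2 \<le> sqrt (real n)" .
    let ?q = "(real (h * l n) * real (card S))\<^sup>2"
    have "real (h * l n) * real (card S) \<ge> 1" using assms(1) l card_S_pos
      by (metis One_nat_def Suc_leI mult_pos_pos of_nat_1 of_nat_le_iff of_nat_mult zero_less_one less_le_trans)
    then have q1: "?q \<ge> 1" by simp
    have "1 / ?q = c / (real (l n))\<^sup>2"
      by (simp add: c_def power_mult_distrib field_simps)
    moreover have "c / (real (l n))\<^sup>2 \<ge> c / sqrt (real n)"
      using l2 l(1) c that by (intro divide_left_mono mult_pos_pos) auto
    ultimately have q: "1 / ?q \<ge> c / sqrt (real n)" by simp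
    have "real (n div 2) \<ge> real n / 2 - 1" by linarith
    moreover have "0 \<le> c / sqrt (real n)" using c by simp
    ultimately have "c / sqrt (real n) * (real n / 2 - 1) \<le> 1 / ?q * real (n div 2)"
      using q by (meson mult_left_mono mult_right_mono of_nat_0_le_iff order_trans)
    have "0 \<le> 1 - 1 / ?q" using q1 by (subst diff_ge_0_iff_ge, subst divide_le_eq_1) auto
    then have "(1 - 1 / ?q) ^ (n div 2) \<le> exp (- (1 / ?q)) ^ (n div 2)"
      using exp_ge_add_one_self[of "- (1 / ?q)"] by (intro power_mono) auto
    also have "\<dots> = exp (- (1 / ?q * real (n div 2)))"
      by (simp add: exp_of_nat_mult[symmetric] algebra_simps)
    also have "\<dots> \<le> exp (- c * (real n / 2 - 1) / sqrt (real n))"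
      using \<open>c / sqrt (real n) * (real n / 2 - 1) \<le> 1 / ?q * real (n div 2)\<close> by simp
    finally have e: "(1 - 1 / ?q) ^ (n div 2) \<le> exp (- c * (real n / 2 - 1) / sqrt (real n))" .
    have "real (card (returning n)) / real (card S) ^ n \<le> even_return (n div 2)"
      by (rule return_probability_le)
    also have "\<dots> \<le> 1 / real (card (val ` W (2 * (h * l n)))) + (1 - 1 / ?q) ^ (n div 2)"
      by (rule even_return_le) (use assms l in simp)
    also have "\<dots> \<le> 1 / 2 ^ l n + (1 - 1 / ?q) ^ (n div 2)"
    proof -
      have "2 ^ l n \<le> real (card (val ` W (2 * (h * l n))))"
        using of_nat_mono[OF growth[of "l n"], where 'a = real] by simp
      moreover from this have "0 < real (card (val ` W (2 * (h * l n))))"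
        by (rule less_le_trans[rotated]) simp
      ultimately show ?thesis by (intro add_right_mono divide_left_mono mult_pos_pos) auto
    qed
    also have "1 / 2 ^ l n = 2 powr (- real (l n))"
      by (simp add: powr_minus powr_realpow field_simps)
    also have "\<dots> \<le> 2 powr (1 - real n powr (1 / 4))"
      using l by simp
    finally show ?thesis using e by linarith
  qed
  have "(\<lambda>n. real n ^ k * (2 powr (1 - real n powr (1 / 4)) + exp (- c * (real n / 2 - 1) / sqrt (real n)))) \<longlonglongrightarrow> 0"
    using c by real_asymp
  then have "\<forall>\<^sub>F n in sequentially. real n ^ k * (2 powr (1 - real n powr (1 / 4)) + exp (- c * (real n / 2 - 1) / sqrt (real n))) < 1"
    by (rule order_tendstoD) simp
  then show ?thesis using eventually_ge_at_top[of 1]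
  proof eventually_elim
    case (elim n)
    with bound[of n] show ?case
      by (meson less_imp_le mult_left_mono of_nat_0_le_iff order_trans zero_le_power)
  qed
qed

end

section \<open>Exponential growth from free products of two blocks\<close>

context symmetric_walk
begin

lemma val_concat:
  assumes "\<And>b. v b \<in> lists S"
  shows "val (concat (map v bs)) = foldr (\<lambda>b g. val (v b) \<otimes> g) bs \<one>"
proof -
  have "concat (map v bs) \<in> lists S" for bs
    using assms by (induction bs) auto
  then show ?thesis
    by (induction bs) (simp_all add: val_append assms)
qed

text \<open>Appending a letter and its formal inverse keeps the value and adds two letters, so words
  of even length can be brought to a common length.\<close>

lemma pad_word:
  assumes "v \<in> W (2 * l)" "l \<le> h"
  obtains v' where "v' \<in> W (2 * h)" "val v' = val v"
proof -
  obtain s where s: "s \<in> S" using S_nonempty by auto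
  have "\<exists>v' \<in> W (2 * (l + j)). val v' = val v" for j
  proof (induction j)
    case 0
    with assms show ?case by auto
  next
    case (Suc j)
    then obtain v' where v': "v' \<in> W (2 * (l + j))" "val v' = val v" by auto
    then have "v' @ [s, \<iota> s] \<in> W (2 * (l + Suc j))"
      using s by (auto simp: W_def \<iota>_closed)
    moreover have "val (v' @ [s, \<iota> s]) = val v"
      using v' s W_val_closed[OF assms(1)] by (simp add: val_append W_lists \<iota>_closed \<phi>_closed \<phi>_\<iota>)
    ultimately show ?case by blast
  qed
  from this[of "h - l"] assms show ?thesis by (auto intro: that)
qed

text \<open>Both blocks have the same length, so all products of \<open>m\<close> blocks are values
  of words of one length, and injectivity makes them distinct.\<close>

lemma card_val_ge_free_products:
  assumes v: "\<And>b :: bool. v b \<in> W (2 * h)"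
    and inj: "inj_on (\<lambda>bs. foldr (\<lambda>b g. val (v b) \<otimes> g) bs \<one>) {bs. length bs = m}"
  shows "card (val ` W (2 * (h * m))) \<ge> 2 ^ m"
proof -
  have len: "length (concat (map v bs)) = 2 * (h * length bs)" for bs
    using v by (induction bs) (auto simp: W_def algebra_simps)
  have mem: "concat (map v bs) \<in> lists S" for bs
    using v by (induction bs) (auto simp: W_def)
  have "2 ^ m = card {bs :: bool list. length bs = m}"
    using card_lists_length_eq[of "UNIV :: bool set" m] by simp
  also have "\<dots> = card ((\<lambda>bs. foldr (\<lambda>b g. val (v b) \<otimes> g) bs \<one>) ` {bs. length bs = m})"
    by (rule card_image[OF inj, symmetric])
  also have "\<dots> \<le> card (val ` W (2 * (h * m)))"
  proof (intro card_mono subsetI)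
    fix g assume "g \<in> (\<lambda>bs. foldr (\<lambda>b g. val (v b) \<otimes> g) bs \<one>) ` {bs. length bs = m}"
    then obtain bs where bs: "length bs = m" "g = foldr (\<lambda>b g. val (v b) \<otimes> g) bs \<one>" by auto
    then have "g = val (concat (map v bs))"
      using v by (subst val_concat) (auto dest: W_lists)
    moreover have "concat (map v bs) \<in> W (2 * (h * m))"
      using len[of bs] mem[of bs] bs(1) by (simp add: W_def)
    ultimately show "g \<in> val ` W (2 * (h * m))" by blast
  qed simp
  finally show ?thesis .
qed

end

section \<open>The lamplighter group\<close>

lemma lamplighter_mult:
  "(F, k) \<otimes>\<^bsub>lamplighter_group p\<^esub> (F', k') = (\<lambda>i. (F i + F' (i - k)) mod int p, k + k')"
  by (simp add: lamplighter_group_def semidirect_product_def restrict_UNIV)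

lemma lamplighter_one: "\<one>\<^bsub>lamplighter_group p\<^esub> = (\<lambda>_. 0, 0)"
  by (simp add: lamplighter_group_def semidirect_product_def restrict_UNIV)

lemma lamplighter_carrier:
  "p > 0 \<Longrightarrow> (F, k) \<in> carrier (lamplighter_group p) \<longleftrightarrow>
     (\<forall>i. 0 \<le> F i \<and> F i < int p) \<and> finite {i. F i \<noteq> 0}"
  by (auto simp: lamplighter_group_def semidirect_product_def carrier_sum_group
      carrier_integer_mod_group PiE_UNIV_domain)

text \<open>
  The elements \<open>lit 2 b\<close> generate a free semigroup. They are squares, hence values of words of even
  length whatever the generators are, as the averaging argument requires.
\<close>

definition lit :: "nat \<Rightarrow> bool \<Rightarrow> (int \<Rightarrow> int) \<times> int" where
  "lit n b = (\<lambda>i. if b \<and> 0 \<le> i \<and> i < int n then 1 else 0, int n)"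

lemma lit_in_carrier: "p > 1 \<Longrightarrow> lit n b \<in> carrier (lamplighter_group p)"
  unfolding lit_def
  by (subst lamplighter_carrier) (auto intro: finite_subset[of _ "{0..<int n}"])

lemma lit_mult_lit: "p > 1 \<Longrightarrow> lit 1 b \<otimes>\<^bsub>lamplighter_group p\<^esub> lit 1 b = lit 2 b"
  by (auto simp: lit_def lamplighter_mult fun_eq_iff)

text \<open>Every factor moves on by two cells, so the factors light disjoint pairs of cells: no
  lamp receives two contributions, and reduction modulo \<open>p\<close> changes nothing.\<close>

lemma foldr_lit_two:
  assumes "p > 1"
  shows "foldr (\<lambda>b g. lit 2 b \<otimes>\<^bsub>lamplighter_group p\<^esub> g) bs \<one>\<^bsub>lamplighter_group p\<^esub> =
    (\<lambda>i. if 0 \<le> i \<and> i < 2 * int (length bs) \<and> bs ! nat (i div 2) then 1 else 0, 2 * int (length bs))"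
proof (induction bs)
  case Nil
  then show ?case by (auto simp: lamplighter_one)
next
  case (Cons b bs)
  have "((if b \<and> 0 \<le> i \<and> i < int 2 then 1 else 0) +
      (if 0 \<le> i - int 2 \<and> i - int 2 < 2 * int (length bs) \<and> bs ! nat ((i - int 2) div 2) then 1 else 0)) mod int p =
      (if 0 \<le> i \<and> i < 2 * int (length (b # bs)) \<and> (b # bs) ! nat (i div 2) then 1 else 0)" for i
  proof (cases "i < 2")
    case True
    then have "0 \<le> i \<Longrightarrow> nat (i div 2) = 0" by simp
    with True assms show ?thesis by auto
  next
    case False
    then have "nat (i div 2) = Suc (nat ((i - 2) div 2))" by simp
    with False assms show ?thesis by auto
  qed
  then show ?case
    unfolding foldr.simps o_apply Cons.IH unfolding lit_def lamplighter_mult by simp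
qed

lemma inj_foldr_lit_two:
  assumes "p > 1"
  shows "inj_on (\<lambda>bs. foldr (\<lambda>b g. lit 2 b \<otimes>\<^bsub>lamplighter_group p\<^esub> g) bs \<one>\<^bsub>lamplighter_group p\<^esub>)
     {bs. length bs = m}"
proof (rule inj_onI, unfold foldr_lit_two[OF assms])
  fix bs cs :: "bool list"
  assume "bs \<in> {bs. length bs = m}" "cs \<in> {bs. length bs = m}"
    and eq: "(\<lambda>i. if 0 \<le> i \<and> i < 2 * int (length bs) \<and> bs ! nat (i div 2) then 1 else 0, 2 * int (length bs)) =
      (\<lambda>i. if 0 \<le> i \<and> i < 2 * int (length cs) \<and> cs ! nat (i div 2) then 1 else (0 :: int), 2 * int (length cs))"
  then have len: "length bs = m" "length cs = m" by auto
  show "bs = cs"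
  proof (rule nth_equalityI)
    fix j assume "j < length bs"
    \<comment> \<open>The lamp in cell \<open>2 * j\<close> records the bit
      \<open>j\<close>.\<close>
    with fun_cong[OF arg_cong[OF eq, of fst], of "2 * int j"] len show "bs ! j = cs ! j"
      by (auto split: if_splits)
  qed (use len in simp)
qed

lemma lamplighter_return_decay:
  assumes "symmetric_walk (lamplighter_group p) S \<phi> \<iota>" "p > 1"
    and onto: "symmetric_walk.val (lamplighter_group p) \<phi> ` lists S = carrier (lamplighter_group p)"
  shows "\<forall>\<^sub>F n in sequentially. real n ^ k * (real (card {w \<in> symmetric_walk.W S n.
           symmetric_walk.val (lamplighter_group p) \<phi> w = \<one>\<^bsub>lamplighter_group p\<^esub>}) / real (card S) ^ n) \<le> 1"
proof -
  interpret symmetric_walk "lamplighter_group p" S \<phi> \<iota> by fact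
  have "\<exists>e \<in> lists S. val e = lit 1 b" for b
    using lit_in_carrier[OF assms(2), of 1 b] onto by (metis imageE)
  then obtain e where e: "\<And>b. e b \<in> lists S" "\<And>b. val (e b) = lit 1 b" by metis
  \<comment> \<open>The sum bounds both lengths, and \<open>Suc\<close> makes \<open>h\<close>
    positive. The doubled words \<open>e b @ e b\<close> have even length and can thus both be
    padded to length \<open>2 * h\<close>.\<close>
  define h where "h = Suc (length (e False) + length (e True))"
  have "\<exists>v \<in> W (2 * h). val v = lit 2 b" for b
  proof -
    have "e b @ e b \<in> W (2 * length (e b))" using e(1) by (auto simp: W_def)
    moreover have "length (e b) \<le> h" by (cases b) (auto simp: h_def)
    ultimately obtain v where "v \<in> W (2 * h)" "val v = val (e b @ e b)" by (rule pad_word)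
    then show ?thesis using e lit_mult_lit[OF assms(2), of b] by (auto simp: val_append intro!: bexI[of _ v])
  qed
  then obtain v where v: "\<And>b. v b \<in> W (2 * h)" "\<And>b. val (v b) = lit 2 b" by metis
  show ?thesis
  proof (rule superpolynomial_return_decay)
    show "h > 0" by (simp add: h_def)
    show "2 ^ m \<le> card (val ` W (2 * (h * m)))" for m
      using v inj_foldr_lit_two[OF assms(2)] by (intro card_val_ge_free_products[where v = v]) auto
  qed
qed

section \<open>Elements of the lamplighter group as programs of lamp operations\<close>

instance move :: countable
  by countable_datatype

type_synonym lamp_program = "(int \<times> move) list"

text \<open>Right multiplication by this element adds to the lamp under the lamplighter and then
  moves the lamplighter. Programs can therefore be executed from left to right while a product is
  tracked.\<close>

definition op_value :: "nat \<Rightarrow> int \<times> move \<Rightarrow> (int \<Rightarrow> int) \<times> int" where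
  "op_value p o1 = (\<lambda>i. if i = 0 then fst o1 mod int p else 0, displacement (snd o1))"

definition program_value :: "nat \<Rightarrow> lamp_program \<Rightarrow> (int \<Rightarrow> int) \<times> int" where
  "program_value p ops = foldr (\<lambda>o1 g. op_value p o1 \<otimes>\<^bsub>lamplighter_group p\<^esub> g) ops \<one>\<^bsub>lamplighter_group p\<^esub>"

lemma program_value_simps [simp]:
  "program_value p [] = \<one>\<^bsub>lamplighter_group p\<^esub>"
  "program_value p (o1 # ops) = op_value p o1 \<otimes>\<^bsub>lamplighter_group p\<^esub> program_value p ops"
  by (simp_all add: program_value_def)

lemma op_value_closed: "p > 0 \<Longrightarrow> op_value p o1 \<in> carrier (lamplighter_group p)"
  unfolding op_value_def
  by (subst lamplighter_carrier) (auto intro: finite_subset[of _ "{0}"])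

lemma program_value_closed: "p > 0 \<Longrightarrow> program_value p ops \<in> carrier (lamplighter_group p)"
proof (induction ops)
  case (Cons o1 ops)
  then show ?case
    by (simp add: op_value_closed group.is_monoid[OF group_lamplighter_group] monoid.m_closed)
qed (simp add: group.is_monoid[OF group_lamplighter_group] monoid.one_closed)

lemma program_value_append:
  assumes "p > 0"
  shows "program_value p (xs @ ys) =
    program_value p xs \<otimes>\<^bsub>lamplighter_group p\<^esub> program_value p ys"
proof -
  interpret group "lamplighter_group p" by (rule group_lamplighter_group)
  show ?thesis
    by (induction xs) (simp_all add: op_value_closed program_value_closed m_assoc assms)
qed

definition walk_program :: "int \<Rightarrow> lamp_program" where
  "walk_program k = replicate (nat \<bar>k\<bar>) (0, if k < 0 then Move_Left else Move_Right)"

lemma program_value_replicate: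
  "program_value p (replicate n (0, m)) = (\<lambda>_. 0, int n * displacement m)"
  by (induction n) (auto simp: lamplighter_one lamplighter_mult op_value_def algebra_simps)

lemma program_value_walk: "program_value p (walk_program k) = (\<lambda>_. 0, k)"
  by (simp add: walk_program_def program_value_replicate)

text \<open>Induction on a finite set containing the support of the lamp configuration, clearing one
  lamp at a time.\<close>

lemma program_exists:
  assumes "p > 0" "g \<in> carrier (lamplighter_group p)"
  shows "\<exists>ops. program_value p ops = g"
proof -
  obtain F k where g: "g = (F, k)" by (cases g)
  have "\<exists>ops. program_value p ops = (F, k)"
    if "finite T" "{i. F i \<noteq> 0} \<subseteq> T" "\<forall>i. 0 \<le> F i \<and> F i < int p" for T F
    using that
  proof (induction T arbitrary: F rule: finite_induct)
    case empty
    then have "F = (\<lambda>_. 0)" by auto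
    then show ?case by (metis program_value_walk)
  next
    case (insert j T)
    have "\<exists>ops. program_value p ops = (F(j := 0), k)"
      by (rule insert.IH) (use insert.prems assms(1) in auto)
    then obtain ops where ops: "program_value p ops = (F(j := 0), k)" ..
    \<comment> \<open>Walk to the lamp \<open>j\<close>, set it, return to the origin, and continue
      with the program for the other lamps and the final position.\<close>
    let ?ops = "walk_program j @ [(F j, Stay)] @ walk_program (- j) @ ops"
    have "program_value p ?ops = (F, k)"
      using insert.prems(2)
      by (auto simp: program_value_append assms(1) program_value_walk ops op_value_def
          lamplighter_mult lamplighter_one fun_eq_iff)
    then show ?case ..
  qed
  moreover have "finite {i. F i \<noteq> 0}" "\<forall>i. 0 \<le> F i \<and> F i < int p"
    using assms by (simp_all add: g lamplighter_carrier)
  ultimately show ?thesis unfolding g by blast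
qed

section \<open>A machine that filters by the image in the lamplighter group\<close>

text \<open>
  In phase \<open>Lamp ops\<close> the operations \<open>ops\<close> of the current letter remain to be executed; an operation
  \<open>(v, m)\<close> adds \<open>v\<close> to the lamp under the head and moves by \<open>m\<close>.
\<close>

datatype phase = Init | Lamp lamp_program | Rewind | Run nat

text \<open>States of a \<open>tm\<close> are natural numbers, so phases become states through
  \<open>to_nat\<close>.\<close>

instance phase :: countable
  by countable_datatype

text \<open>A dark lamp is a blank cell, so that a fresh tape already represents the
  identity.\<close>

definition enc :: "int \<Rightarrow> 'a symbol" where
  "enc v = (if v = 0 then Blank else Aux (nat v))"

fun dec :: "'a symbol \<Rightarrow> int" where
  "dec (Aux n) = int n"
| "dec _ = 0"

lemma dec_enc: "0 \<le> v \<Longrightarrow> dec (enc v) = v"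
  by (simp add: enc_def)

abbreviation keep :: "'a symbol \<Rightarrow> 'a symbol \<times> move" where
  "keep s \<equiv> (s, Stay)"

text \<open>
  The three additional tapes are placed between the input tape and the work tapes of \<open>M\<close>. A unary
  counter is a tape whose only nonblank cell is the cell \<open>0\<close>, the value being the head position.
\<close>

locale lamplighter_filter =
  fixes p :: nat and A :: "'a set" and M :: "'a tm" and prog :: "'a \<Rightarrow> lamp_program"
  assumes p: "p > 1" and M: "turing_machine A M"
begin

text \<open>\<open>Lamp []\<close> loads the program of the next letter or, past the input, inspects
  the two counters. The counter of lit lamps moves only when a lamp changes between zero and
  nonzero. The guard in phase \<open>Run\<close> is there because the tape alphabet may contain
  symbols unknown to \<open>M\<close>, on which \<open>trans M\<close> is unspecified.\<close>

fun next_phase :: "phase \<Rightarrow> 'a symbol list \<Rightarrow> phase \<times> ('a symbol \<times> move) list" where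
  "next_phase Init (i # a # b # c # ss) =
     (Lamp [], keep i # keep a # keep (Aux 0) # keep (Aux 0) # map keep ss)"
| "next_phase (Lamp ((v, m) # ops)) (i # a # b # c # ss) =
     (let x = dec a; y = (x + v) mod int p in
      (Lamp ops, keep i # (enc y, m) #
         (b, if x = 0 \<and> y \<noteq> 0 then Move_Right else if x \<noteq> 0 \<and> y = 0 then Move_Left else Stay) #
         (c, m) # map keep ss))"
| "next_phase (Lamp []) (i # a # b # c # ss) =
     (if i \<in> Input ` A then
        (Lamp (prog (the_inv Input i)), (i, Move_Right) # map keep (a # b # c # ss))
      else if b = Aux 0 \<and> c = Aux 0 then (Rewind, (i, Move_Left) # map keep (a # b # c # ss))
      else (Run (reject M), map keep (i # a # b # c # ss)))"
| "next_phase Rewind (i # a # b # c # ss) =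
     (if i = Blank then (Run (start M), (i, Move_Right) # map keep (a # b # c # ss))
      else (Rewind, (i, Move_Left) # map keep (a # b # c # ss)))"
| "next_phase (Run q) (i # a # b # c # ss) =
     (if q \<in> states M - {accept M, reject M} \<and> i # ss \<in> lists (symbols M) then
        (case trans M q (i # ss) of (q', acts) \<Rightarrow>
           (Run q', hd acts # keep a # keep b # keep c # tl acts))
      else (Run (reject M), map keep (i # a # b # c # ss)))"
| "next_phase ph ss = (Run (reject M), map keep ss)"

text \<open>What remains of a program during its execution is a suffix of it, so finitely many
  phases suffice.\<close>

definition phases :: "phase set" where
  "phases = {Init, Rewind, Lamp []} \<union> Run ` states M \<union> Lamp ` (\<Union>s\<in>A. set (suffixes (prog s)))"

definition work_symbols :: "'a symbol set" where
  "work_symbols = symbols M \<union> Aux ` {..<p}"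

definition N :: "'a tm" where
  "N = \<lparr>tapes = tapes M + 3, states = to_nat ` phases, start = to_nat Init,
        accept = to_nat (Run (accept M)), reject = to_nat (Run (reject M)),
        symbols = work_symbols,
        trans = (\<lambda>q ss. map_prod to_nat id (next_phase (from_nat q) ss))\<rparr>"

section \<open>The filter is a Turing machine\<close>

lemma M_props:
  shows "tapes M \<ge> 1" "finite (states M)" "start M \<in> states M" "accept M \<in> states M"
    "reject M \<in> states M" "accept M \<noteq> reject M" "finite (symbols M)" "Blank \<in> symbols M"
    "Input ` A \<subseteq> symbols M"
proof -
  have "tapes M \<ge> 1 \<and> finite (states M) \<and> {start M, accept M, reject M} \<subseteq> states M \<and>
      accept M \<noteq> reject M \<and> finite (symbols M) \<and> Blank \<in> symbols M \<and> Input ` A \<subseteq> symbols M"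
    using M unfolding turing_machine_def by (elim conjE, intro conjI)
  then show "tapes M \<ge> 1" "finite (states M)" "start M \<in> states M" "accept M \<in> states M"
    "reject M \<in> states M" "accept M \<noteq> reject M" "finite (symbols M)" "Blank \<in> symbols M"
    "Input ` A \<subseteq> symbols M"
    by simp_all
qed

lemma M_trans:
  assumes "q \<in> states M - {accept M, reject M}" "ss \<in> lists (symbols M)" "length ss = tapes M"
    "trans M q ss = (q', acts)"
  shows "q' \<in> states M" "length acts = tapes M" "fst ` set acts \<subseteq> symbols M"
proof -
  have "\<forall>q \<in> states M - {accept M, reject M}. \<forall>ss \<in> lists (symbols M). length ss = tapes M \<longrightarrow>
      (case trans M q ss of (q', acts) \<Rightarrow>
        q' \<in> states M \<and> length acts = tapes M \<and> fst ` set acts \<subseteq> symbols M)"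
    using M unfolding turing_machine_def by (elim conjE)
  from mp[OF bspec[OF bspec[OF this assms(1)] assms(2)] assms(3)]
  have "case trans M q ss of (q', acts) \<Rightarrow>
      q' \<in> states M \<and> length acts = tapes M \<and> fst ` set acts \<subseteq> symbols M" .
  with assms(4) show "q' \<in> states M" "length acts = tapes M" "fst ` set acts \<subseteq> symbols M"
    by simp_all
qed

lemma finite_A: "finite A"
  using finite_subset[OF M_props(9,7)] by (rule finite_imageD) (simp add: inj_on_def)

lemma the_inv_Input [simp]: "the_inv Input (Input s) = s"
  by (rule the_inv_f_f) (simp add: inj_on_def)

lemma enc_symbols: "enc (x mod int p) \<in> work_symbols"
proof -
  have "0 \<le> x mod int p" "x mod int p < int p" using p by auto
  then show ?thesis using M_props(8) by (auto simp: enc_def work_symbols_def)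
qed

lemma act_values_keep: "fst ` set (map keep xs) = set xs"
  by force

lemma next_phase_valid:
  assumes ph: "ph \<in> phases" and len: "length ss = tapes M + 3"
    and ss: "set ss \<subseteq> work_symbols"
    and eq: "next_phase ph ss = (ph', acts)"
  shows "ph' \<in> phases \<and> length acts = tapes M + 3 \<and> fst ` set acts \<subseteq> work_symbols"
proof -
  obtain i a b c r where abc: "ss = i # a # b # c # r" and r: "length (i # r) = tapes M"
  proof -
    have "length ss = Suc (Suc (Suc (Suc (tapes M - 1))))" using len M_props(1) by simp
    then obtain i a b c r where "ss = i # a # b # c # r" "length r = tapes M - 1"
      by (auto simp only: length_Suc_conv)
    with that M_props(1) show ?thesis by simp
  qed
  have blank: "Aux 0 \<in> work_symbols"
    using p by (auto simp: work_symbols_def)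
  have rej: "Run (reject M) \<in> phases" "Run (start M) \<in> phases" "Rewind \<in> phases" "Lamp [] \<in> phases"
    using M_props(3,5) by (simp_all add: phases_def)
  have prog: "Lamp (prog s) \<in> phases" if "s \<in> A" for s
  proof -
    have "prog s \<in> set (suffixes (prog s))" by simp
    with that show ?thesis unfolding phases_def by blast
  qed
  note eq = eq[unfolded abc] and ss = ss[unfolded abc]
  \<comment> \<open>Covers all transitions that change no symbol and move at most the input
    head.\<close>
  have kept: ?thesis
    if "ph' \<in> phases" "acts = (i, m) # map keep (a # b # c # r)" for m
  proof -
    have "fst ` set acts = set (i # a # b # c # r)"
      by (simp only: that(2) list.set image_insert act_values_keep fst_conv)
    then show ?thesis using that r ss by simp
  qed
  show ?thesis
  proof (cases ph)
    case Init
    then have "ph' = Lamp []" "acts = keep i # keep a # keep (Aux 0) # keep (Aux 0) # map keep r"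
      using eq by simp_all
    moreover from this have "fst ` set acts = set (i # a # Aux 0 # Aux 0 # r)"
      by (simp only: list.set image_insert act_values_keep fst_conv)
    ultimately show ?thesis using r ss blank rej by simp
  next
    case Rewind
    show ?thesis
    proof (cases "i = Blank")
      case True
      then show ?thesis using eq rej by (intro kept[of Move_Right]) (auto simp: Rewind)
    next
      case False
      then show ?thesis using eq rej by (intro kept[of Move_Left]) (simp_all add: Rewind)
    qed
  next
    case (Run q)
    show ?thesis
    proof (cases "q \<in> states M - {accept M, reject M} \<and> i # r \<in> lists (symbols M)")
      case True
      obtain q' acts' where t: "trans M q (i # r) = (q', acts')" by fastforce
      note v = M_trans[OF conjunct1[OF True] conjunct2[OF True] r t]
      with M_props(1) obtain x xs where acts': "acts' = x # xs" by (cases acts') simp_all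
      have eqs: "ph' = Run q'" "acts = x # keep a # keep b # keep c # xs"
        using eq True by (simp_all add: Run t acts')
      have "fst ` set acts = insert a (insert b (insert c (fst ` set acts')))"
        by (auto simp: eqs acts')
      moreover have "fst ` set acts' \<subseteq> work_symbols"
        using v(3) by (auto simp: work_symbols_def)
      moreover have "ph' \<in> phases" using v(1) by (simp add: eqs phases_def)
      ultimately show ?thesis using v(2) ss by (simp add: eqs acts')
    next
      case False
      have "next_phase ph (i # a # b # c # r) = (Run (reject M), map keep (i # a # b # c # r))"
        unfolding Run next_phase.simps by (rule if_not_P[OF False])
      then show ?thesis using eq rej by (intro kept[of Stay]) auto
    qed
  next
    case (Lamp ops)
    show ?thesis
    proof (cases ops)
      case Nil
      consider s where "s \<in> A" "i = Input s" | "i \<notin> Input ` A" "b = Aux 0 \<and> c = Aux 0"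
        | "i \<notin> Input ` A" "\<not> (b = Aux 0 \<and> c = Aux 0)" by blast
      then show ?thesis
      proof cases
        case (1 s)
        then show ?thesis using eq prog[OF 1(1)] by (intro kept[of Move_Right]) (auto simp: Nil Lamp)
      next
        case 2
        then show ?thesis using eq rej by (intro kept[of Move_Left]) (simp_all add: Nil Lamp)
      next
        case 3
        then have "next_phase ph (i # a # b # c # r) = (Run (reject M), map keep (i # a # b # c # r))"
          unfolding Nil Lamp next_phase.simps by (simp only: if_False)
        then show ?thesis using eq rej by (intro kept[of Stay]) auto
      qed
    next
      case (Cons o1 ops')
      obtain v m where o1: "o1 = (v, m)" by (cases o1)
      have "Lamp ops' \<in> phases"
      proof -
        from ph obtain s where "s \<in> A" "suffix ops (prog s)"
          unfolding Lamp phases_def using Cons by auto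
        then have "ops' \<in> set (suffixes (prog s))" using suffix_ConsD[of o1 ops' "prog s"] Cons by simp
        with \<open>s \<in> A\<close> show ?thesis unfolding phases_def by blast
      qed
      moreover have "ph' = Lamp ops' \<and>
          (\<exists>d. acts = keep i # (enc ((dec a + v) mod int p), m) # (b, d) # (c, m) # map keep r)"
        using eq by (auto simp: Lamp Cons o1 Let_def)
      then obtain d where acts: "ph' = Lamp ops'"
          "acts = keep i # (enc ((dec a + v) mod int p), m) # (b, d) # (c, m) # map keep r"
        by blast
      moreover have "fst ` set acts = set (i # enc ((dec a + v) mod int p) # b # c # r)"
        by (simp only: acts list.set image_insert act_values_keep fst_conv)
      ultimately show ?thesis using r ss enc_symbols[of "dec a + v"] by simp
    qed
  qed
qed

lemma turing_machine_N: "turing_machine A N"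
proof -
  have "case trans N q ss of (q', acts) \<Rightarrow> q' \<in> states N \<and> length acts = tapes N \<and> fst ` set acts \<subseteq> symbols N"
    if N: "q \<in> states N" "ss \<in> lists (symbols N)" "length ss = tapes N" for q ss
  proof -
    obtain ph where ph: "ph \<in> phases" "q = to_nat ph" using N(1) by (auto simp: N_def)
    obtain ph' acts where eq: "next_phase ph ss = (ph', acts)" by fastforce
    have "length ss = tapes M + 3" "set ss \<subseteq> work_symbols"
      using N(2,3) by (auto simp: N_def)
    from next_phase_valid[OF ph(1) this eq] ph eq show ?thesis
      by (simp add: N_def)
  qed
  moreover have "finite phases"
    using M_props finite_A by (auto simp: phases_def)
  ultimately show ?thesis
    using M_props unfolding turing_machine_def
    by (auto simp: N_def phases_def work_symbols_def)
qed

section \<open>Tracking the image of the input\<close>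

lemma act_keep_eq: "scan t = s \<Longrightarrow> act (keep s) t = t"
  by (cases t) auto

lemma step_N:
  assumes "ph \<noteq> Run (accept M)" "ph \<noteq> Run (reject M)"
  shows "step N (to_nat ph, ts) =
    (case next_phase ph (map scan ts) of (ph', acts) \<Rightarrow> (to_nat ph', map2 act acts ts))"
proof -
  have "\<not> halting N (to_nat ph, ts)" using assms by (simp add: halting_def N_def)
  moreover obtain ph' acts where "next_phase ph (map scan ts) = (ph', acts)" by fastforce
  moreover from this have "trans N (to_nat ph) (map scan ts) = (to_nat ph', acts)"
    by (simp add: N_def)
  ultimately show ?thesis by (simp add: step_def)
qed

lemma act_keep [simp]: "act (keep (scan t)) t = t"
  by (cases t) simp

lemma map2_act_keep [simp]: "map2 act (map keep (map scan ts)) ts = ts"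
  by (induction ts) auto

definition lamp_tape :: "(int \<Rightarrow> int) \<times> int \<Rightarrow> 'a tape" where
  "lamp_tape g = (snd g, \<lambda>i. enc (fst g i))"

definition mark_tape :: "int \<Rightarrow> 'a tape" where
  "mark_tape k = (k, (\<lambda>_. Blank)(0 := Aux 0))"

definition track :: "phase \<Rightarrow> 'a tape \<Rightarrow> (int \<Rightarrow> int) \<times> int \<Rightarrow> 'a tape list \<Rightarrow> 'a config" where
  "track ph t g ts =
     (to_nat ph, t # lamp_tape g # mark_tape (int (card {i. fst g i \<noteq> 0})) # mark_tape (snd g) # ts)"

lemma act_mark_tape: "act (scan (mark_tape k), m) (mark_tape k) = mark_tape (k + displacement m)"
  by (auto simp: mark_tape_def fun_eq_iff)

text \<open>Only the lamp under the lamplighter changes, so the number of lit lamps changes by at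
  most one, in the direction \<open>d\<close> determined by the old and the new value of that
  lamp.\<close>

lemma step_op:
  assumes g: "g \<in> carrier (lamplighter_group p)"
  shows "step N (track (Lamp (o1 # ops)) t g ts) =
     track (Lamp ops) t (g \<otimes>\<^bsub>lamplighter_group p\<^esub> op_value p o1) ts"
proof -
  obtain F k where [simp]: "g = (F, k)" by (cases g)
  obtain v m where [simp]: "o1 = (v, m)" by (cases o1)
  have F: "\<And>i. 0 \<le> F i" "\<And>i. F i < int p" "finite {i. F i \<noteq> 0}"
    using g p by (auto simp: lamplighter_carrier)
  define y where "y = (F k + v) mod int p"
  define d where "d = (if F k = 0 \<and> y \<noteq> 0 then Move_Right else if F k \<noteq> 0 \<and> y = 0 then Move_Left else Stay)"
  have mult: "g \<otimes>\<^bsub>lamplighter_group p\<^esub> op_value p o1 = (F(k := y), k + displacement m)"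
    using F by (auto simp: lamplighter_mult op_value_def y_def fun_eq_iff mod_simps)
  have count: "int (card {i. (F(k := y)) i \<noteq> 0}) = int (card {i. F i \<noteq> 0}) + displacement d"
  proof (cases "F k = 0")
    case True
    show ?thesis
    proof (cases "y = 0")
      case False
      have "{i. (F(k := y)) i \<noteq> 0} = insert k {i. F i \<noteq> 0}" using False by auto
      then show ?thesis using True False F by (simp add: d_def)
    next
      case y: True
      have "F(k := y) = F" using y True by auto
      then show ?thesis using True y by (simp add: d_def)
    qed
  next
    case nz: False
    show ?thesis
    proof (cases "y = 0")
      case False
      have "{i. (F(k := y)) i \<noteq> 0} = {i. F i \<noteq> 0}" using False nz by auto
      then show ?thesis using nz False by (simp add: d_def)
    next
      case True
      have "{i. F i \<noteq> 0} = insert k {i. (F(k := y)) i \<noteq> 0}" using True nz by auto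
      moreover have "finite {i. (F(k := y)) i \<noteq> 0}" by (rule finite_subset[OF _ F(3)]) (use nz in auto)
      ultimately have "card {i. F i \<noteq> 0} = Suc (card {i. (F(k := y)) i \<noteq> 0})"
        using True by simp
      then show ?thesis using True nz by (simp add: d_def)
    qed
  qed
  have lamp: "act (enc y, m) (lamp_tape (F, k)) = lamp_tape (F(k := y), k + displacement m)"
    by (auto simp: lamp_tape_def)
  have scan: "dec (scan (lamp_tape (F, k))) = F k"
    using F by (simp add: lamp_tape_def dec_enc)
  let ?c = "mark_tape (int (card {i. F i \<noteq> 0}))"
  have "step N (track (Lamp (o1 # ops)) t g ts) =
    (to_nat (Lamp ops), map2 act (keep (scan t) # (enc y, m) # (scan ?c, d) # (scan (mark_tape k), m) # map keep (map scan ts))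
      (t # lamp_tape (F, k) # ?c # mark_tape k # ts))"
    unfolding track_def by (subst step_N) (simp_all add: Let_def scan y_def d_def)
  also have "\<dots> = track (Lamp ops) t (g \<otimes>\<^bsub>lamplighter_group p\<^esub> op_value p o1) ts"
    unfolding mult track_def
    by (simp add: act_mark_tape lamp count del: map_map fun_upd_apply)
  finally show ?thesis .
qed

lemma steps_program:
  assumes "g \<in> carrier (lamplighter_group p)"
  shows "(step N ^^ length ops) (track (Lamp ops) t g ts) =
     track (Lamp []) t (g \<otimes>\<^bsub>lamplighter_group p\<^esub> program_value p ops) ts"
  using assms
proof (induction ops arbitrary: g)
  case Nil
  interpret group "lamplighter_group p" by (rule group_lamplighter_group)
  show ?case using Nil by simp
next
  case (Cons o1 ops)
  interpret group "lamplighter_group p" by (rule group_lamplighter_group)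
  have "op_value p o1 \<in> carrier (lamplighter_group p)" "program_value p ops \<in> carrier (lamplighter_group p)"
    using p by (simp_all add: op_value_closed program_value_closed)
  then show ?case
    using Cons by (simp add: funpow_Suc_right step_op m_assoc del: funpow.simps)
qed

definition cells :: "'a list \<Rightarrow> int \<Rightarrow> 'a symbol" where
  "cells w = (\<lambda>i. if 0 \<le> i \<and> i < int (length w) then Input (w ! nat i) else Blank)"

definition lamps :: "'a list \<Rightarrow> (int \<Rightarrow> int) \<times> int" where
  "lamps w = foldr (\<lambda>s g. program_value p (prog s) \<otimes>\<^bsub>lamplighter_group p\<^esub> g) w \<one>\<^bsub>lamplighter_group p\<^esub>"

lemma lamps_simps [simp]:
  "lamps [] = \<one>\<^bsub>lamplighter_group p\<^esub>"
  "lamps (s # w) = program_value p (prog s) \<otimes>\<^bsub>lamplighter_group p\<^esub> lamps w"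
  by (simp_all add: lamps_def)

lemma lamps_closed [simp]: "lamps w \<in> carrier (lamplighter_group p)"
proof -
  interpret group "lamplighter_group p" by (rule group_lamplighter_group)
  show ?thesis using p by (induction w) (simp_all add: program_value_closed)
qed

text \<open>The sum is a crude bound for the longest program; \<open>Suc\<close> pays for the step
  that reads the letter.\<close>

definition max_program :: nat where
  "max_program = Suc (\<Sum>s\<in>A. length (prog s))"

lemma length_prog_less: "s \<in> A \<Longrightarrow> length (prog s) < max_program"
  unfolding max_program_def less_Suc_eq_le by (rule member_le_sum) (auto simp: finite_A)

lemma step_read:
  assumes "s \<in> A"
  shows "step N (track (Lamp []) (int (length u), cells (u @ s # v)) g ts) =
     track (Lamp (prog s)) (int (length (u @ [s])), cells (u @ s # v)) g ts"
proof -
  have *: "cells (u @ s # v) (int (length u)) = Input s"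
    by (simp add: cells_def)
  then show ?thesis
    unfolding track_def using assms
    by (subst step_N) (auto simp: fun_upd_idem simp del: map_map)
qed

text \<open>Generalised over the prefix \<open>u\<close> already read and the element
  \<open>g\<close> tracked so far, for the induction on the remaining input.\<close>

lemma steps_read:
  assumes "v \<in> lists A" "g \<in> carrier (lamplighter_group p)"
  shows "\<exists>n \<le> max_program * length v.
    (step N ^^ n) (track (Lamp []) (int (length u), cells (u @ v)) g ts) =
      track (Lamp []) (int (length (u @ v)), cells (u @ v)) (g \<otimes>\<^bsub>lamplighter_group p\<^esub> lamps v) ts"
  using assms
proof (induction v arbitrary: u g rule: list.induct)
  case Nil
  interpret group "lamplighter_group p" by (rule group_lamplighter_group)
  show ?case using Nil by simp
next
  case (Cons s v)
  interpret group "lamplighter_group p" by (rule group_lamplighter_group)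
  let ?g = "g \<otimes>\<^bsub>lamplighter_group p\<^esub> program_value p (prog s)"
  have s: "s \<in> A" "v \<in> lists A" using Cons.prems by auto
  have ps: "program_value p (prog s) \<in> carrier (lamplighter_group p)"
    using p by (simp add: program_value_closed)
  then have "?g \<in> carrier (lamplighter_group p)" using Cons.prems by simp
  from Cons.IH[OF s(2) this, of "u @ [s]"] obtain n where n: "n \<le> max_program * length v"
    "(step N ^^ n) (track (Lamp []) (int (length (u @ [s])), cells (u @ s # v)) ?g ts) =
      track (Lamp []) (int (length (u @ s # v)), cells (u @ s # v)) (?g \<otimes>\<^bsub>lamplighter_group p\<^esub> lamps v) ts"
    by auto
  have "(step N ^^ Suc (length (prog s))) (track (Lamp []) (int (length u), cells (u @ s # v)) g ts) =
     track (Lamp []) (int (length (u @ [s])), cells (u @ s # v)) ?g ts"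
    by (simp only: funpow_Suc_right o_apply step_read[OF s(1)] steps_program[OF Cons.prems(2)])
  then have "(step N ^^ (n + Suc (length (prog s)))) (track (Lamp []) (int (length u), cells (u @ s # v)) g ts) =
      track (Lamp []) (int (length (u @ s # v)), cells (u @ s # v)) (?g \<otimes>\<^bsub>lamplighter_group p\<^esub> lamps v) ts"
    by (simp only: funpow_add o_apply n)
  moreover have "n + Suc (length (prog s)) \<le> max_program * length (s # v)"
    using n(1) length_prog_less[OF s(1)] by simp
  moreover have "?g \<otimes>\<^bsub>lamplighter_group p\<^esub> lamps v = g \<otimes>\<^bsub>lamplighter_group p\<^esub> lamps (s # v)"
    using ps Cons.prems by (simp add: m_assoc)
  ultimately show ?case by metis
qed

definition blanks :: "'a tape list" where
  "blanks = replicate (tapes M - 1) blank_tape"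

lemma initial_M: "initial M w = (start M, (0, cells w) # blanks)"
  by (simp add: initial_def input_tape_def cells_def blanks_def)

lemma initial_N: "initial N w = (to_nat Init, (0, cells w) # replicate 3 blank_tape @ blanks)"
proof -
  have "tapes N - 1 = 3 + (tapes M - 1)" using M_props(1) by (simp add: N_def)
  moreover have "start N = to_nat Init" by (simp add: N_def)
  ultimately show ?thesis
    by (simp only: initial_def input_tape_def cells_def blanks_def replicate_add)
qed

text \<open>The identity has a blank lamp tape, so only the marks of the two counters have to be
  written.\<close>

lemma step_Init:
  "step N (initial N w) = track (Lamp []) (0, cells w) \<one>\<^bsub>lamplighter_group p\<^esub> blanks"
proof -
  have "replicate 3 (blank_tape :: 'a tape) = [blank_tape, blank_tape, blank_tape]"
    by (simp add: numeral_3_eq_3)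
  moreover have "act (keep (Aux 0)) blank_tape = mark_tape 0"
    by (simp add: blank_tape_def mark_tape_def)
  moreover have "lamp_tape \<one>\<^bsub>lamplighter_group p\<^esub> = blank_tape"
    by (simp add: lamp_tape_def blank_tape_def lamplighter_one enc_def)
  moreover have "card {i. fst \<one>\<^bsub>lamplighter_group p\<^esub> i \<noteq> 0} = 0" "snd \<one>\<^bsub>lamplighter_group p\<^esub> = 0"
    by (simp_all add: lamplighter_one)
  ultimately show ?thesis
    unfolding initial_N track_def by (subst step_N) (simp_all del: map_map)
qed

lemma steps_input:
  assumes "w \<in> lists A"
  shows "\<exists>n \<le> max_program * length w + 1.
    config_at N w n = track (Lamp []) (int (length w), cells w) (lamps w) blanks"
proof -
  interpret group "lamplighter_group p" by (rule group_lamplighter_group)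
  from steps_read[OF assms one_closed, of "[]" blanks] obtain n where n: "n \<le> max_program * length w"
    "(step N ^^ n) (track (Lamp []) (0, cells w) \<one>\<^bsub>lamplighter_group p\<^esub> blanks) =
      track (Lamp []) (int (length w), cells w) (lamps w) blanks"
    by auto
  have "config_at N w (Suc n) = track (Lamp []) (int (length w), cells w) (lamps w) blanks"
    by (simp only: config_at_def funpow_Suc_right o_apply step_Init n)
  with n(1) show ?thesis by (intro exI[of _ "Suc n"]) simp
qed

section \<open>Checking triviality and rewinding\<close>

lemma scan_mark_tape: "scan (mark_tape k) = Aux 0 \<longleftrightarrow> k = 0"
  by (simp add: mark_tape_def)

text \<open>The support is finite, so cardinality 0 means that all lamps are dark;
  \<open>card\<close> of an infinite set would be 0 as well.\<close>

lemma marks_iff: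
  assumes "g \<in> carrier (lamplighter_group p)"
  shows "scan (mark_tape (int (card {i. fst g i \<noteq> 0}))) = Aux 0 \<and> scan (mark_tape (snd g)) = Aux 0 \<longleftrightarrow>
     g = \<one>\<^bsub>lamplighter_group p\<^esub>"
proof -
  obtain F k where [simp]: "g = (F, k)" by (cases g)
  have "finite {i. F i \<noteq> 0}" using assms p by (auto simp: lamplighter_carrier)
  then show ?thesis by (auto simp: scan_mark_tape lamplighter_one)
qed

lemma cells_length: "cells w (int (length w)) = Blank"
  by (simp add: cells_def)

lemma step_reject:
  assumes "lamps w \<noteq> \<one>\<^bsub>lamplighter_group p\<^esub>"
  shows "fst (step N (track (Lamp []) (int (length w), cells w) (lamps w) ts)) = reject N"
proof -
  have "\<not> (scan (mark_tape (int (card {i. fst (lamps w) i \<noteq> 0}))) = Aux 0 \<and> scan (mark_tape (snd (lamps w))) = Aux 0)"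
    using assms marks_iff[OF lamps_closed] by blast
  then show ?thesis
    unfolding track_def
    by (subst step_N) (auto simp: cells_length N_def simp del: map_map)
qed

lemma step_rewind_start:
  assumes "lamps w = \<one>\<^bsub>lamplighter_group p\<^esub>"
  shows "step N (track (Lamp []) (int (length w), cells w) (lamps w) ts) =
     track Rewind (int (length w) - 1, cells w) (lamps w) ts"
proof -
  have "scan (mark_tape (int (card {i. fst (lamps w) i \<noteq> 0}))) = Aux 0 \<and> scan (mark_tape (snd (lamps w))) = Aux 0"
    using assms marks_iff[OF lamps_closed] by blast
  then show ?thesis
    unfolding track_def
    by (subst step_N) (auto simp: cells_length fun_upd_idem act_keep_eq simp del: map_map)
qed

text \<open>From cell \<open>j - 1\<close> the head crosses \<open>j\<close> letters; the extra step
  bounces off the blank cell \<open>-1\<close> back to cell 0.\<close>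

lemma steps_rewind:
  assumes "j \<le> length w"
  shows "(step N ^^ Suc j) (track Rewind (int j - 1, cells w) g ts) = track (Run (start M)) (0, cells w) g ts"
  using assms
proof (induction j)
  case 0
  have "cells w (- 1) = Blank" by (simp add: cells_def)
  then show ?case
    unfolding track_def
    by (simp, subst step_N) (auto simp: fun_upd_idem simp del: map_map)
next
  case (Suc j)
  have "cells w (int j) \<noteq> Blank" using Suc.prems by (simp add: cells_def)
  then have "step N (track Rewind (int (Suc j) - 1, cells w) g ts) = track Rewind (int j - 1, cells w) g ts"
    unfolding track_def
    by (subst step_N) (auto simp: fun_upd_idem simp del: map_map)
  then have "(step N ^^ Suc (Suc j)) (track Rewind (int (Suc j) - 1, cells w) g ts) =
      (step N ^^ Suc j) (track Rewind (int j - 1, cells w) g ts)"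
    by (simp only: funpow_Suc_right[of "Suc j"] o_apply)
  with Suc show ?case by simp
qed

section \<open>Simulation of \<open>M\<close> on the outer tapes\<close>

definition valid :: "'a config \<Rightarrow> bool" where
  "valid c \<longleftrightarrow> fst c \<in> states M \<and> length (snd c) = tapes M \<and>
     (\<forall>t \<in> set (snd c). range (snd t) \<subseteq> symbols M)"

definition lift :: "(int \<Rightarrow> int) \<times> int \<Rightarrow> 'a config \<Rightarrow> 'a config" where
  "lift g c = track (Run (fst c)) (hd (snd c)) g (tl (snd c))"

lemma valid_initial:
  assumes "w \<in> lists A"
  shows "valid (initial M w)"
proof -
  have "cells w i \<in> symbols M" for i
  proof (cases "0 \<le> i \<and> i < int (length w)")
    case True
    then have "w ! nat i \<in> A" using assms nth_mem[of "nat i" w] by auto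
    with M_props(9) True show ?thesis by (auto simp: cells_def)
  next
    case False
    then have "cells w i = Blank" unfolding cells_def by (rule if_not_P)
    then show ?thesis by (simp add: M_props(8))
  qed
  moreover have "range (snd blank_tape) \<subseteq> symbols M"
    using M_props(8) by (auto simp: blank_tape_def)
  ultimately show ?thesis
    using M_props(1,3) by (simp add: valid_def initial_M blanks_def image_subset_iff)
qed

lemma map_scan_symbols:
  assumes "valid (q, ts)"
  shows "map scan ts \<in> lists (symbols M)"
proof -
  have "scan t \<in> range (snd t)" for t :: "'a tape" by (cases t) simp
  with assms show ?thesis by (fastforce simp: valid_def)
qed

lemma step_valid:
  assumes "valid c"
  shows "valid (step M c)"
proof (cases "halting M c")
  case True
  then show ?thesis using assms by (simp add: step_def)
next
  case False
  obtain q ts where c: "c = (q, ts)" by (cases c)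
  obtain q' acts where t: "trans M q (map scan ts) = (q', acts)" by fastforce
  have q: "q \<in> states M - {accept M, reject M}" "length ts = tapes M"
    using assms False by (auto simp: valid_def halting_def c)
  from M_trans[OF q(1) map_scan_symbols _ t] assms q
  have v: "q' \<in> states M" "length acts = tapes M" "fst ` set acts \<subseteq> symbols M" by (auto simp: c)
  have "range (snd (act a t)) \<subseteq> symbols M" if "a \<in> set acts" "t \<in> set ts" for a t
  proof -
    obtain s m i f where [simp]: "a = (s, m)" "t = (i, f)" by (cases a, cases t)
    have "range f \<subseteq> symbols M" "s \<in> symbols M"
      using that assms v by (fastforce simp: valid_def c)+
    then show ?thesis by auto
  qed
  then have "\<forall>t \<in> set (map2 act acts ts). range (snd t) \<subseteq> symbols M"
    by (fastforce dest: set_zip_leftD set_zip_rightD)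
  then show ?thesis
    using v q False by (simp add: step_def valid_def c t)
qed

text \<open>Validity makes the guard of phase \<open>Run\<close> true until \<open>M\<close> halts,
  and the three inserted tapes are left alone. Once \<open>M\<close> has halted, both machines are
  stationary.\<close>

lemma step_lift:
  assumes "valid c"
  shows "step N (lift g c) = lift g (step M c)"
proof -
  obtain q t ts where c: "c = (q, t # ts)"
    using assms M_props(1) by (cases c, cases "snd c") (auto simp: valid_def)
  show ?thesis
  proof (cases "q = accept M \<or> q = reject M")
    case True
    then show ?thesis
      by (auto simp: c lift_def track_def step_def halting_def N_def)
  next
    case False
    obtain q' acts where t: "trans M q (map scan (t # ts)) = (q', acts)" by fastforce
    have q: "q \<in> states M - {accept M, reject M}" "length (t # ts) = tapes M"
      using assms False by (auto simp: valid_def c)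
    have sym: "map scan (t # ts) \<in> lists (symbols M)"
      using assms by (intro map_scan_symbols) (simp add: c)
    from M_trans(2)[OF q(1) sym _ t] q have "length acts = tapes M" by simp
    then obtain a as where acts: "acts = a # as" using M_props(1) by (cases acts) auto
    have "step M c = (q', act a t # map2 act as ts)"
      using False t by (simp add: step_def halting_def c acts)
    moreover have "step N (lift g c) = track (Run q') (act a t) g (map2 act as ts)"
      using False t q sym unfolding lift_def track_def c
      by (subst step_N) (auto simp: acts simp del: map_map)
    ultimately show ?thesis by (simp add: lift_def)
  qed
qed

lemma steps_lift:
  "valid c \<Longrightarrow> (step N ^^ n) (lift g c) = lift g ((step M ^^ n) c)"
proof (induction n arbitrary: c)
  case (Suc n)
  then show ?case by (simp only: funpow_Suc_right o_apply step_lift step_valid)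
qed simp

lemma halting_lift: "halting N (lift g c) \<longleftrightarrow> halting M c"
  by (auto simp: halting_def lift_def track_def N_def)

section \<open>Correctness and running time of the filter\<close>

lemma nontrivial_rejected:
  assumes "w \<in> lists A" "lamps w \<noteq> \<one>\<^bsub>lamplighter_group p\<^esub>"
  shows "\<exists>n \<le> max_program * length w + 2. fst (config_at N w n) = reject N"
proof -
  from steps_input[OF assms(1)] obtain n where n: "n \<le> max_program * length w + 1"
    "config_at N w n = track (Lamp []) (int (length w), cells w) (lamps w) blanks" by auto
  have "config_at N w (Suc n) = step N (config_at N w n)" by (simp add: config_at_def)
  with n step_reject[OF assms(2)] have "fst (config_at N w (Suc n)) = reject N" by simp
  with n(1) show ?thesis by (intro exI[of _ "Suc n"]) simp
qed

lemma trivial_simulated: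
  assumes "w \<in> lists A" "lamps w = \<one>\<^bsub>lamplighter_group p\<^esub>"
  shows "\<exists>n \<le> max_program * length w + length w + 3.
     \<forall>m. config_at N w (n + m) = lift (lamps w) (config_at M w m)"
proof -
  from steps_input[OF assms(1)] obtain n where n: "n \<le> max_program * length w + 1"
    "config_at N w n = track (Lamp []) (int (length w), cells w) (lamps w) blanks" by auto
  \<comment> \<open>After the \<open>n\<close> steps of reading, one step turns the input head back,
    and \<open>length w + 1\<close> steps rewind it.\<close>
  have "config_at N w (Suc (length w) + Suc n) = lift (lamps w) (initial M w)"
  proof -
    have "config_at N w (Suc (length w) + Suc n) = (step N ^^ Suc (length w)) (step N (config_at N w n))"
      unfolding config_at_def funpow_add o_apply by simp
    also have "\<dots> = track (Run (start M)) (0, cells w) (lamps w) blanks"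
      by (simp only: n(2) step_rewind_start[OF assms(2)] steps_rewind[OF order_refl])
    finally show ?thesis by (simp add: lift_def initial_M)
  qed
  then have "config_at N w (Suc (length w) + Suc n + m) = lift (lamps w) (config_at M w m)" for m
    unfolding add.commute[of _ m] config_at_def funpow_add[of m] o_apply
    by (simp only: steps_lift[OF valid_initial[OF assms(1)]])
  with n(1) show ?thesis by (intro exI[of _ "Suc (length w) + Suc n"]) auto
qed

text \<open>Words in \<open>L\<close> have trivial image, so rejecting a nontrivial image is
  correct; on all other words the answer of \<open>M\<close> is reproduced.\<close>

lemma decides_N:
  assumes M: "decides A M L" and L: "\<And>w. w \<in> L \<Longrightarrow> lamps w = \<one>\<^bsub>lamplighter_group p\<^esub>"
  shows "decides A N L"
  unfolding decides_def
proof (intro conjI ballI turing_machine_N)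
  fix w assume w: "w \<in> lists A"
  show "\<exists>t. fst (config_at N w t) = (if w \<in> L then accept N else reject N)"
  proof (cases "lamps w = \<one>\<^bsub>lamplighter_group p\<^esub>")
    case True
    from M w obtain m where "fst (config_at M w m) = (if w \<in> L then accept M else reject M)"
      unfolding decides_def by blast
    moreover from trivial_simulated[OF w True] obtain n where
      "config_at N w (n + m) = lift (lamps w) (config_at M w m)" by auto
    ultimately have "fst (config_at N w (n + m)) = (if w \<in> L then accept N else reject N)"
      by (simp add: lift_def track_def N_def)
    then show ?thesis ..
  next
    case False
    with nontrivial_rejected[OF w False] L show ?thesis by auto
  qed
qed

text \<open>Reading and rewinding take linear time; the time of \<open>M\<close> is paid only if the
  image is trivial.\<close>

lemma running_time_N:
  assumes M: "decides A M L" and w: "w \<in> lists A"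
  shows "running_time N w \<le> (max_program + 1) * length w + 3 +
    (if lamps w = \<one>\<^bsub>lamplighter_group p\<^esub> then running_time M w else 0)"
proof (cases "lamps w = \<one>\<^bsub>lamplighter_group p\<^esub>")
  case True
  have "\<exists>m. fst (config_at M w m) = (if w \<in> L then accept M else reject M)"
    using M w by (simp add: decides_def)
  then obtain m where "fst (config_at M w m) = (if w \<in> L then accept M else reject M)" ..
  then have "halting M (config_at M w m)" by (auto simp: halting_def split: if_splits)
  then have "halting M (config_at M w (running_time M w))"
    unfolding running_time_def by (rule LeastI)
  moreover from trivial_simulated[OF w True] obtain n where n: "n \<le> max_program * length w + length w + 3"
      "config_at N w (n + running_time M w) = lift (lamps w) (config_at M w (running_time M w))" by auto
  ultimately have "halting N (config_at N w (n + running_time M w))"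
    by (simp add: halting_lift)
  then have "running_time N w \<le> n + running_time M w"
    unfolding running_time_def[of N] by (rule Least_le)
  with n(1) True show ?thesis by simp
next
  case False
  from nontrivial_rejected[OF w False] obtain n where n: "n \<le> max_program * length w + 2"
    "fst (config_at N w n) = reject N" by auto
  then have "running_time N w \<le> n"
    unfolding running_time_def by (intro Least_le) (simp add: halting_def)
  with n(1) False show ?thesis by simp
qed

end

section \<open>The average-case complexity\<close>

fun formal_inverse :: "'g letter \<Rightarrow> 'g letter" where
  "formal_inverse (Gen x) = Inv x"
| "formal_inverse (Inv x) = Gen x"

lemma formal_inverse_involution: "formal_inverse (formal_inverse s) = s"
  by (cases s) auto

lemma formal_inverse_letters: "s \<in> letters X \<Longrightarrow> formal_inverse s \<in> letters X"
  by (auto simp: letters_def)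

lemma word_value_simps [simp]:
  "word_value G [] = \<one>\<^bsub>G\<^esub>"
  "word_value G (s # w) = letter_value G s \<otimes>\<^bsub>G\<^esub> word_value G w"
  by (simp_all add: word_value_def)

context group
begin

lemma letter_value_closed: "X \<subseteq> carrier G \<Longrightarrow> s \<in> letters X \<Longrightarrow> letter_value G s \<in> carrier G"
  by (auto simp: letters_def)

lemma letter_value_formal_inverse:
  "X \<subseteq> carrier G \<Longrightarrow> s \<in> letters X \<Longrightarrow> letter_value G (formal_inverse s) = inv letter_value G s"
  by (auto simp: letters_def)

lemma word_value_closed:
  "X \<subseteq> carrier G \<Longrightarrow> w \<in> lists (letters X) \<Longrightarrow> word_value G w \<in> carrier G"
  by (induction w rule: list.induct) (auto simp: letter_value_closed)

lemma word_value_append: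
  assumes "X \<subseteq> carrier G" "v \<in> lists (letters X)" "w \<in> lists (letters X)"
  shows "word_value G (v @ w) = word_value G v \<otimes> word_value G w"
  using assms(2)
  by (induction v rule: list.induct)
    (use assms in \<open>auto simp: m_assoc word_value_closed letter_value_closed\<close>)

lemma generate_word_value:
  assumes "X \<subseteq> carrier G" "g \<in> generate G X"
  shows "\<exists>w \<in> lists (letters X). word_value G w = g"
  using assms(2)
proof (induction rule: generate.induct)
  case one
  show ?case by (rule bexI[of _ "[]"]) auto
next
  case (incl x)
  with assms(1) show ?case by (intro bexI[of _ "[Gen x]"]) (auto simp: letters_def)
next
  case (inv x)
  with assms(1) show ?case by (intro bexI[of _ "[Inv x]"]) (auto simp: letters_def)
next
  case (eng x y)
  then obtain v w where "v \<in> lists (letters X)" "w \<in> lists (letters X)"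
    "word_value G v = x" "word_value G w = y" by auto
  with assms(1) show ?case by (intro bexI[of _ "v @ w"]) (auto simp: word_value_append)
qed

end

theorem theorem4:
  fixes G :: "('g, 'b) monoid_scheme" and X :: "'g set" and p :: nat
    and f :: "'g \<Rightarrow> (int \<Rightarrow> int) \<times> int"
  assumes "prime p"
    and "group G"
    and "finite X" and "X \<subseteq> carrier G" and "generate G X = carrier G"
    and "polynomial_worst_case_word_problem G X"
    and "f \<in> epi G (lamplighter_group p)"
  shows "linear_average_case_word_problem G X"
proof -
  interpret G: group G by fact
  let ?L = "lamplighter_group p"
  interpret L: group ?L by (rule group_lamplighter_group)
  have p: "p > 1" using \<open>prime p\<close> by (rule prime_gt_1_nat)
  interpret f: group_hom G ?L f
    using assms(7) by unfold_locales (simp add: epi_def)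
  have f_onto: "f ` carrier G = carrier ?L" using assms(7) by (simp add: epi_def)
  define \<phi> where "\<phi> = (\<lambda>s. f (letter_value G s))"
  \<comment> \<open>Without letters \<open>G\<close> would be trivial, yet \<open>lit 1 True\<close>
    is a nontrivial element of its image.\<close>
  have "letters X \<noteq> {}"
  proof
    assume "letters X = {}"
    then have "carrier G = {\<one>\<^bsub>G\<^esub>}" using assms(5) G.generate_empty by (simp add: letters_def)
    then have "carrier ?L = {\<one>\<^bsub>?L\<^esub>}" using f_onto by simp
    then have "lit 1 True = \<one>\<^bsub>?L\<^esub>" using lit_in_carrier[OF p, of 1 True] by simp
    then show False by (simp add: lit_def lamplighter_one)
  qed
  then have walk: "symmetric_walk ?L (letters X) \<phi> formal_inverse"
    using assms(3,4)
    by unfold_locales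
      (auto simp: \<phi>_def formal_inverse_letters formal_inverse_involution G.letter_value_closed
        G.letter_value_formal_inverse letters_def)
  interpret symmetric_walk ?L "letters X" \<phi> formal_inverse by (rule walk)
  have \<phi>: "\<phi> s = f (letter_value G s)" for s by (simp add: \<phi>_def)
  \<comment> \<open>Hence a word that is trivial in \<open>G\<close> has trivial image, which is the
    condition of \<open>decides_N\<close>.\<close>
  have val: "val w = f (word_value G w)" if "w \<in> lists (letters X)" for w
    using that
    by (induction w rule: list.induct)
      (use assms(4) in \<open>auto simp: \<phi> G.word_value_closed G.letter_value_closed\<close>)
  have onto: "val ` lists (letters X) = carrier ?L"
  proof -
    have "word_value G ` lists (letters X) = carrier G"
      using G.generate_word_value[OF assms(4)] G.word_value_closed[OF assms(4)] assms(5) by blast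
    then show ?thesis
      unfolding f_onto[symmetric] by (metis (no_types, lifting) image_cong image_image val)
  qed
  have W: "words X n = W n" for n by (simp add: words_def W_def)

  obtain M k C where M: "solves_word_problem G X M"
    and time: "\<forall>\<^sub>F n in sequentially. \<forall>w \<in> words X n. real (running_time M w) \<le> C * real n ^ k"
    using assms(6) by (auto simp: polynomial_worst_case_word_problem_def)
  let ?WP = "{w \<in> lists (letters X). word_value G w = \<one>\<^bsub>G\<^esub>}"
  have dec: "decides (letters X) M ?WP"
    using M by (simp add: solves_word_problem_def)
  \<comment> \<open>A program for the image of each letter instantiates the filter, so that the
    element it tracks is the value of the walk.\<close>
  have "\<exists>ops. program_value p ops = \<phi> s" if "s \<in> letters X" for s
    using that p by (intro program_exists) (auto simp: \<phi>_closed)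
  then obtain prog where prog: "\<And>s. s \<in> letters X \<Longrightarrow> program_value p (prog s) = \<phi> s" by metis
  interpret lamplighter_filter p "letters X" M prog
    using p dec by unfold_locales (simp_all add: decides_def)
  have lamps: "lamps w = val w" if "w \<in> lists (letters X)" for w
    using that by (induction w rule: list.induct) (auto simp: prog)
  have "solves_word_problem G X N"
    unfolding solves_word_problem_def
    by (rule decides_N[OF dec]) (simp add: lamps val)
  moreover have "average_time X N \<in> O(\<lambda>n. real n)"
  proof (rule bigoI)
    let ?c = "max_program + 1"
    \<comment> \<open>The summands pay for the linear part of the filter, its additive constant 3,
      and the expected time of \<open>M\<close>. The last is at most \<open>\<bar>C\<bar>\<close>,
      since \<open>n ^ k\<close> times the return probability is eventually at most 1. The sign of
      \<open>C\<close> is unknown, hence the absolute value; \<open>n \<ge> 1\<close> absorbs the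
      constants.\<close>
    show "\<forall>\<^sub>F n in sequentially. norm (average_time X N n) \<le> (real ?c + 3 + \<bar>C\<bar>) * norm (real n)"
      using time lamplighter_return_decay[OF walk p onto, of k] eventually_ge_at_top[of 1]
    proof eventually_elim
      case (elim n)
      have pos: "real (card (W n)) > 0" using card_S_pos by (simp add: card_W)
      have "(\<Sum>w\<in>W n. real (running_time N w)) \<le>
          (\<Sum>w\<in>W n. real (?c * n + 3) + (if val w = \<one>\<^bsub>?L\<^esub> then \<bar>C\<bar> * real n ^ k else 0))"
      proof (rule sum_mono)
        fix w assume w: "w \<in> W n"
        then have w': "w \<in> lists (letters X)" "length w = n" by (simp_all add: W_def)
        have "real (running_time M w) \<le> C * real n ^ k" using elim(1) w by (simp add: W)
        also have "\<dots> \<le> \<bar>C\<bar> * real n ^ k" by (intro mult_right_mono) auto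
        finally have "real (running_time M w) \<le> \<bar>C\<bar> * real n ^ k" .
        moreover have "real (running_time N w) \<le>
            real (?c * n + 3 + (if val w = \<one>\<^bsub>?L\<^esub> then running_time M w else 0))"
          using running_time_N[OF dec w'(1)] unfolding lamps[OF w'(1)] w'(2) by (rule of_nat_mono)
        ultimately show "real (running_time N w) \<le>
            real (?c * n + 3) + (if val w = \<one>\<^bsub>?L\<^esub> then \<bar>C\<bar> * real n ^ k else 0)"
          by (auto split: if_splits)
      qed
      also have "\<dots> = real (card (W n)) * real (?c * n + 3) + real (card (returning n)) * (\<bar>C\<bar> * real n ^ k)"
        by (simp add: sum.distrib sum.If_cases Int_def)
      finally have "average_time X N n \<le>
          (real (card (W n)) * real (?c * n + 3) + real (card (returning n)) * (\<bar>C\<bar> * real n ^ k)) / real (card (W n))"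
        unfolding average_time_def W by (intro divide_right_mono) auto
      also have "\<dots> = real (?c * n + 3) + \<bar>C\<bar> * (real n ^ k * (real (card (returning n)) / real (card (W n))))"
        using pos by (auto simp: add_divide_distrib)
      also have "\<dots> \<le> real (?c * n + 3) + \<bar>C\<bar> * 1"
        using elim(2) by (intro add_left_mono mult_left_mono) (simp_all add: card_W)
      also have "\<dots> \<le> (real ?c + 3 + \<bar>C\<bar>) * real n"
      proof -
        have "3 \<le> 3 * real n" "\<bar>C\<bar> * 1 \<le> \<bar>C\<bar> * real n"
          using elim(3) mult_left_mono[of 1 "real n" "\<bar>C\<bar>"] by simp_all
        then show ?thesis by (simp add: algebra_simps)
      qed
      finally have "average_time X N n \<le> (real ?c + 3 + \<bar>C\<bar>) * real n" .
      moreover have "average_time X N n \<ge> 0"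
        unfolding average_time_def by (intro divide_nonneg_nonneg sum_nonneg) auto
      ultimately show ?case by simp
    qed
  qed
  ultimately show ?thesis
    unfolding linear_average_case_word_problem_def by blast
qed

end
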